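(* For every $n\ge2$, every integer $1\le k<n$, every unconditional convex body $L$ in $\mathbb{R}^n$, and every measure $\mu$ with even continuous non-negative density on $L$, $$\mu(L)\ \le\ e^k\,\frac{n}{n-k}\,c_{n,k}\,\max_{H\in Gr_{n-k}}\mu(L\cap H)\,|L|^{k/n}.$$
   Context: A convex body $L$ in $\mathbb{R}^n$ (compact convex set with non-empty interior containing the origin in its interior) is unconditional if $\|\sum_{i=1}^n\delta_ix_ie_i\|_L=\|\sum_{i=1}^n x_ie_i\|_L$ for all real $x_i$ and all signs $\delta_i=\pm1$, where $e_1,\dots,e_n$ is the standard basis and $\|x\|_L=\min\{a\ge0:x\in aL\}$. $Gr_{n-k}$ is the Grassmannian of $(n-k)$-dimensional linear subspaces of $\mathbb{R}^n$. If $\mu$ has density $g$, $\mu(L)=\int_L g$ and $\mu(L\cap H)=\int_{L\cap H}g$ with respect to $(n-k)$-dimensional Lebesgue measure on $H$. $|L|$ is volume, $B_2^m$ the Euclidean unit ball in $\mathbb{R}^m$, and $c_{n,k}=|B_2^n|^{\frac{n-k}{n}}/|B_2^{n-k}|$. *)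

theory Defs
  imports "HOL-Analysis.Analysis"
begin

definition gauge_of :: "'a::euclidean_space set \<Rightarrow> 'a \<Rightarrow> real" where
  "gauge_of L x = Inf {a. a \<ge> 0 \<and> x \<in> (\<lambda>y. a *\<^sub>R y) ` L}"

definition convex_body :: "'a::euclidean_space set \<Rightarrow> bool" where
  "convex_body L \<longleftrightarrow> compact L \<and> convex L \<and> 0 \<in> interior L"

definition unconditional :: "'a::euclidean_space set \<Rightarrow> bool" where
  "unconditional L \<longleftrightarrow>
     (\<forall>x (\<delta>::'a \<Rightarrow> real). (\<forall>i\<in>Basis. \<delta> i = 1 \<or> \<delta> i = -1) \<longrightarrow>
        gauge_of L (\<Sum>i\<in>Basis. (\<delta> i * (x \<bullet> i)) *\<^sub>R i) = gauge_of L x)"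

definition Grass :: "nat \<Rightarrow> 'a::euclidean_space set set" where
  "Grass m = {H. subspace H \<and> dim H = m}"

definition onb_of :: "'a::euclidean_space set \<Rightarrow> (nat \<Rightarrow> 'a) \<Rightarrow> bool" where
  "onb_of H b \<longleftrightarrow> (\<forall>i<dim H. \<forall>j<dim H. b i \<bullet> b j = (if i = j then 1 else 0))
                    \<and> span (b ` {..<dim H}) = H"

text \<open>Integral of g over L \<inter> H with respect to dim(H)-dimensional Lebesgue measure on H,
  computed by the isometric parametrisation t \<mapsto> \<Sum> t_i b_i of H by R^{dim H}
  (independent of the chosen orthonormal basis).\<close>
definition section_integral :: "('a::euclidean_space \<Rightarrow> real) \<Rightarrow> 'a set \<Rightarrow> 'a set \<Rightarrow> real" where
  "section_integral g L H =
     (let m = dim H; b = (SOME b. onb_of H b) in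
       integral\<^sup>L (PiM {..<m} (\<lambda>_. lborel))
         (\<lambda>t. indicator L (\<Sum>i<m. t i *\<^sub>R b i) * g (\<Sum>i<m. t i *\<^sub>R b i)))"

definition c_nk :: "nat \<Rightarrow> nat \<Rightarrow> real" where
  "c_nk n k = unit_ball_vol (real n) powr ((real n - real k) / real n) / unit_ball_vol (real n - real k)"

end

theory Submission
  imports Defs "HOL-Real_Asymp.Real_Asymp"
begin

text \<open>
  Let the box \<open>[-a, a]\<close> have largest volume among the coordinate boxes in \<open>L\<close>. First-order
  optimality puts \<open>L\<close> inside the cross-polytope \<open>D = {N \<le> 1}\<close> with \<open>N x = \<Sum>i. \<bar>x \<bullet> i\<bar> / (n a\<^sub>i)\<close>,
  and \<open>|D| \<le> e\<^sup>n |L|\<close> by Markov's inequality for \<open>exp (- n N)\<close>.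

  The measure \<open>N\<^sup>-\<^sup>k dx\<close> is a mixture of multiples of Lebesgue measure on \<open>(n - k)\<close>-dimensional
  subspaces, namely the common kernels of \<open>k\<close> independent random covectors with Cauchy entries.
  Hence any bound \<open>\<integral>\<^sub>H F \<le> C |B \<inter> H|\<close>, valid for all such subspaces \<open>H\<close> and the Euclidean unit ball \<open>B\<close>,
  integrates to \<open>\<integral> F N\<^sup>-\<^sup>k \<le> C \<integral>\<^sub>B N\<^sup>-\<^sup>k\<close>. With \<open>F = g\<close> on \<open>L\<close>, where \<open>N \<le> 1\<close>, the left-hand side is at
  least \<open>\<integral>\<^sub>L g\<close>, while a layer cake computation bounds \<open>\<integral>\<^sub>B N\<^sup>-\<^sup>k\<close> in terms of \<open>|B|\<close> and \<open>|D|\<close>.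
  The mixture is built one hyperplane at a time, so no determinants appear.
\<close>

section \<open>Unconditional bodies and cross-polytopes\<close>

text \<open>Why a cross-polytope: Cauchy laws are 1-stable, so a linear form with independent Cauchy
  coefficients, evaluated at \<open>x\<close>, is Cauchy with a weighted l1-norm of \<open>x\<close>
  as scale. The gauge of \<open>L\<close> itself need not admit such a representation, so
  \<open>L\<close> is first enclosed in a body whose gauge does. The obstacle is normalisation: the
  random subspaces come with bases that are not orthonormal and with weights that have no convenient
  total mass. Only comparisons of two integrands over the same subspace are used, so Gram factors
  and weights cancel. The Euclidean ball is the comparison integrand because its central sections of
  a given dimension all have the same volume. Constants: \<open>n / (n - k)\<close> comes from
  integrating the layer cake, \<open>exp k\<close> is the \<open>k / n\<close>-th power of the
  volume loss \<open>exp n\<close>, and \<open>c_nk\<close> joins the power of the volume of the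
  ball from the layer cake with the reciprocal volume of its sections.\<close>

lemma gauge_of_le_1_iff:
  fixes L :: "'a::euclidean_space set"
  assumes "convex_body L"
  shows "gauge_of L x \<le> 1 \<longleftrightarrow> x \<in> L"
proof -
  let ?S = "{a. a \<ge> 0 \<and> x \<in> (\<lambda>y. a *\<^sub>R y) ` L}"
  have L: "closed L" "convex L" "0 \<in> interior L" "0 \<in> L"
    using assms interior_subset by (auto simp: convex_body_def compact_imp_closed)
  have bdd: "bdd_below ?S" by (rule bdd_belowI[of _ 0]) auto
  show ?thesis
  proof
    assume "x \<in> L"
    then have "1 \<in> ?S" by force
    then show "gauge_of L x \<le> 1" unfolding gauge_of_def using bdd by (rule cInf_lower)
  next
    assume le: "gauge_of L x \<le> 1"
    \<comment> \<open>A ball inside \<open>L\<close> shows that some multiple of \<open>L\<close>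
      contains \<open>x\<close>, so the infimum in \<open>gauge_of\<close> runs over a nonempty
      set.\<close>
    obtain e where e: "e > 0" "ball 0 e \<subseteq> L"
      using L(3) by (auto simp: mem_interior)
    define t where "t = e / (2 * (norm x + 1))"
    have t: "t > 0" using e(1) by (simp add: t_def add_nonneg_pos)
    have "norm (t *\<^sub>R x) < e"
    proof -
      have "norm (t *\<^sub>R x) = e * (norm x / (2 * (norm x + 1)))" using t e by (simp add: t_def)
      also have "\<dots> < e * 1"
        using e(1) norm_ge_zero[of x] by (intro mult_strict_left_mono) (auto simp: divide_simps add_nonneg_pos)
      finally show ?thesis by simp
    qed
    then have "t *\<^sub>R x \<in> L" using e(2) by auto
    moreover have "x = (1/t) *\<^sub>R (t *\<^sub>R x)" using t by simp
    ultimately have "1 / t \<in> ?S" using t by (blast intro: less_imp_le zero_less_divide_1_iff[THEN iffD2])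
    then have ne: "?S \<noteq> {}" by blast
    \<comment> \<open>The infimum is not known to be attained, so \<open>x\<close> is reached as a
      limit of points \<open>x / (1 + d)\<close> of the closed set \<open>L\<close>.\<close>
    have scaled: "(1 / (1 + d)) *\<^sub>R x \<in> L" if "d > 0" for d :: real
    proof -
      have "Inf ?S < 1 + d" using le that by (simp add: gauge_of_def)
      then obtain b where b: "b \<in> ?S" "b < 1 + d" using cInf_lessD[OF ne] by blast
      then obtain z where z: "z \<in> L" "x = b *\<^sub>R z" by auto
      have "(b / (1 + d)) *\<^sub>R z + (1 - b / (1 + d)) *\<^sub>R 0 \<in> L"
        using L b that z by (intro convexD) (auto simp: divide_simps)
      then show ?thesis using z by simp
    qed
    have "(\<lambda>n. (1 / (1 + 1 / real (Suc n))) *\<^sub>R x) \<longlonglongrightarrow> (1 / (1 + 0)) *\<^sub>R x"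
      by (intro tendsto_intros LIMSEQ_Suc[OF lim_1_over_n]) auto
    then have "(1 / (1 + 0)) *\<^sub>R x \<in> L"
      by (rule closed_sequentially[OF L(1) _, rotated]) (intro scaled, simp)
    then show "x \<in> L" by simp
  qed
qed

lemma unconditional_flip:
  fixes L :: "'a::euclidean_space set"
  assumes "convex_body L" "unconditional L" "x \<in> L"
    and "\<And>i. i \<in> Basis \<Longrightarrow> \<bar>y \<bullet> i\<bar> = \<bar>x \<bullet> i\<bar>"
  shows "y \<in> L"
proof -
  define \<delta> where "\<delta> i = (if y \<bullet> i = x \<bullet> i then 1 else -1 :: real)" for i
  have "gauge_of L (\<Sum>i\<in>Basis. (\<delta> i * (x \<bullet> i)) *\<^sub>R i) = gauge_of L x"
    using assms(2) by (auto simp: unconditional_def \<delta>_def)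
  moreover have "(\<Sum>i\<in>Basis. (\<delta> i * (x \<bullet> i)) *\<^sub>R i) = y"
  proof -
    have "\<delta> i * (x \<bullet> i) = y \<bullet> i" if "i \<in> Basis" for i
      using assms(4)[OF that] by (auto simp: \<delta>_def abs_if split: if_splits)
    then have "(\<Sum>i\<in>Basis. (\<delta> i * (x \<bullet> i)) *\<^sub>R i) = (\<Sum>i\<in>Basis. (y \<bullet> i) *\<^sub>R i)"
      by (intro sum.cong) auto
    then show ?thesis by (simp add: euclidean_representation)
  qed
  ultimately show ?thesis using gauge_of_le_1_iff[OF assms(1)] assms(3) by metis
qed

text \<open>Coordinates are shrunk one at a time. With the others fixed, \<open>y\<close> lies on
  the segment between the two points whose \<open>j\<close>-th coordinate is plus or minus
  \<open>\<bar>x \<bullet> j\<bar>\<close>, and the induction hypothesis covers both end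
  points.\<close>

lemma unconditional_solid:
  fixes L :: "'a::euclidean_space set"
  assumes L: "convex_body L" "unconditional L" and x: "x \<in> L"
    and y: "\<And>i. i \<in> Basis \<Longrightarrow> \<bar>y \<bullet> i\<bar> \<le> \<bar>x \<bullet> i\<bar>"
  shows "y \<in> L"
proof -
  have conv: "convex L" using L by (simp add: convex_body_def)
  have "\<forall>y. (\<forall>i\<in>S. \<bar>y \<bullet> i\<bar> \<le> \<bar>x \<bullet> i\<bar>) \<and> (\<forall>i\<in>Basis - S. \<bar>y \<bullet> i\<bar> = \<bar>x \<bullet> i\<bar>) \<longrightarrow> y \<in> L"
    if "S \<subseteq> Basis" for S :: "'a set"
    using finite_subset[OF that finite_Basis] that
  proof (induction S rule: finite_induct)
    case empty
    then show ?case using unconditional_flip[OF L x] by auto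
  next
    case (insert j S)
    show ?case
    proof (intro allI impI, elim conjE)
      fix y assume y1: "\<forall>i\<in>insert j S. \<bar>y \<bullet> i\<bar> \<le> \<bar>x \<bullet> i\<bar>"
        and y2: "\<forall>i\<in>Basis - insert j S. \<bar>y \<bullet> i\<bar> = \<bar>x \<bullet> i\<bar>"
      define A where "A = \<bar>x \<bullet> j\<bar>"
      have j: "j \<in> Basis" using insert by auto
      have z: "y + (\<tau> - y \<bullet> j) *\<^sub>R j \<in> L" if "\<bar>\<tau>\<bar> = A" for \<tau>
      proof -
        have c: "(y + (\<tau> - y \<bullet> j) *\<^sub>R j) \<bullet> i = (if i = j then \<tau> else y \<bullet> i)" if "i \<in> Basis" for i
          using j that by (auto simp: inner_add_left inner_Basis)
        show ?thesis
          using insert.IH insert.prems insert.hyps y1 y2 c that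
          by (auto simp: A_def subset_iff)
      qed
      show "y \<in> L"
      proof (cases "A = 0")
        case True
        then show ?thesis using z[of 0] y1 by (auto simp: A_def)
      next
        case False
        then have A: "A > 0" by (simp add: A_def)
        \<comment> \<open>The weight solving
          \<open>u * A + (1 - u) * (- A) = y \<bullet> j\<close>.\<close>
        define u where "u = (y \<bullet> j + A) / (2 * A)"
        have yj: "\<bar>y \<bullet> j\<bar> \<le> A" using y1 by (simp add: A_def)
        have u: "0 \<le> u" "u \<le> 1" using yj A by (auto simp: u_def field_simps)
        have "u *\<^sub>R (y + (A - y \<bullet> j) *\<^sub>R j) + (1 - u) *\<^sub>R (y + (- A - y \<bullet> j) *\<^sub>R j) \<in> L"
          using z[of A] z[of "-A"] A u conv by (intro convexD) auto
        also have "u *\<^sub>R (y + (A - y \<bullet> j) *\<^sub>R j) + (1 - u) *\<^sub>R (y + (- A - y \<bullet> j) *\<^sub>R j)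
           = y + (u * (2 * A) - A - y \<bullet> j) *\<^sub>R j"
          by (simp add: algebra_simps flip: scaleR_add_left)
        also have "\<dots> = y" using A by (simp add: u_def)
        finally show ?thesis .
      qed
    qed
  qed
  from this[of Basis] y show ?thesis by auto
qed

text \<open>The product is 1 at \<open>t = 0\<close> and has derivative \<open>sum d I\<close>
  there, so a positive sum would push it above 1 for small \<open>t\<close>. This is the first-order
  condition at a box of maximal volume.\<close>

lemma sum_nonpos_of_prod_le_1:
  fixes d :: "'i \<Rightarrow> real"
  assumes "finite I" and le: "\<And>t. 0 \<le> t \<Longrightarrow> t \<le> 1 \<Longrightarrow> (\<Prod>i\<in>I. 1 + t * d i) \<le> 1"
  shows "sum d I \<le> 0"
proof (rule ccontr)
  assume pos: "\<not> sum d I \<le> 0"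
  have "((\<lambda>t. \<Prod>i\<in>I. 1 + t * d i) has_real_derivative (\<Sum>i\<in>I. d i * (\<Prod>j\<in>I - {i}. 1 + 0 * d j))) (at 0)"
    by (rule has_field_derivative_prod) (auto intro!: derivative_eq_intros)
  then have "((\<lambda>t. \<Prod>i\<in>I. 1 + t * d i) has_real_derivative sum d I) (at 0)" by simp
  then obtain e where e: "e > 0" "\<And>h. 0 < h \<Longrightarrow> h < e \<Longrightarrow> (\<Prod>i\<in>I. 1 + 0 * d i) < (\<Prod>i\<in>I. 1 + (0 + h) * d i)"
    using DERIV_pos_inc_right[of "\<lambda>t. \<Prod>i\<in>I. 1 + t * d i" "sum d I" 0] pos by auto
  define h where "h = min 1 (e / 2)"
  have "0 < h" "h < e" "h \<le> 1" using e by (auto simp: h_def)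
  then show False using e(2)[of h] le[of h] by simp
qed

text \<open>Lozanovskii's position: the box is the one of largest volume inside the body.\<close>
lemma unconditional_position:
  fixes L :: "'a::euclidean_space set"
  assumes L: "convex_body L" "unconditional L"
  obtains a where "\<And>i. i \<in> Basis \<Longrightarrow> a \<bullet> i > 0" "cbox (- a) a \<subseteq> L"
    "\<And>x. x \<in> L \<Longrightarrow> (\<Sum>i\<in>Basis. \<bar>x \<bullet> i\<bar> / (a \<bullet> i)) \<le> DIM('a)"
proof -
  have conv: "compact L" "convex L" "0 \<in> interior L" using L by (auto simp: convex_body_def)
  \<comment> \<open>Up to the factor \<open>2 ^ n\<close>, the volume of the symmetric box with
    corner \<open>x\<close>.\<close>
  let ?f = "\<lambda>x::'a. \<Prod>i\<in>Basis. \<bar>x \<bullet> i\<bar>"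
  have "L \<noteq> {}" using conv interior_subset by blast
  moreover have "continuous_on L ?f" by (intro continuous_intros)
  ultimately obtain a0 where a0: "a0 \<in> L" "\<And>y. y \<in> L \<Longrightarrow> ?f y \<le> ?f a0"
    using continuous_attains_sup[OF conv(1), of ?f] by blast
  define a where "a = (\<Sum>i\<in>Basis. \<bar>a0 \<bullet> i\<bar> *\<^sub>R i)"
  have ai: "a \<bullet> i = \<bar>a0 \<bullet> i\<bar>" if "i \<in> Basis" for i using that by (simp add: a_def)
  have aL: "a \<in> L" by (rule unconditional_flip[OF L a0(1)]) (simp add: ai)
  have fa: "?f a = ?f a0" by (simp add: ai)
  obtain e where e: "e > 0" "cball 0 e \<subseteq> L"
    using conv(3) by (auto simp: mem_interior_cball)
  \<comment> \<open>A point of \<open>L\<close> without zero coordinates: it makes the maximum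
    positive and hence every side of the optimal box nondegenerate.\<close>
  have "(e / real DIM('a)) *\<^sub>R (One::'a) \<in> L"
  proof -
    have "norm (One::'a) \<le> (\<Sum>i\<in>Basis. norm (i::'a))" by (rule norm_sum)
    then have "norm (One::'a) \<le> DIM('a)" by simp
    then have "norm ((e / real DIM('a)) *\<^sub>R (One::'a)) \<le> (e / DIM('a)) * DIM('a)"
      unfolding norm_scaleR using e by (intro mult_mono) auto
    then show ?thesis using e by (auto simp: subset_iff)
  qed
  from a0(2)[OF this] have "?f a > 0"
    unfolding fa by (rule less_le_trans[rotated]) (use e in \<open>auto intro!: prod_pos\<close>)
  then have "\<forall>i\<in>Basis. \<bar>a \<bullet> i\<bar> \<noteq> 0" by (metis finite_Basis less_irrefl prod_zero_iff)
  then have apos: "a \<bullet> i > 0" if "i \<in> Basis" for i using ai that by auto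
  show thesis
  proof
    show "a \<bullet> i > 0" if "i \<in> Basis" for i by (rule apos[OF that])
    show "cbox (- a) a \<subseteq> L"
    proof
      fix y assume y: "y \<in> cbox (- a) a"
      show "y \<in> L"
      proof (rule unconditional_solid[OF L aL])
        fix i :: 'a assume "i \<in> Basis"
        then show "\<bar>y \<bullet> i\<bar> \<le> \<bar>a \<bullet> i\<bar>" using y apos[of i] by (auto simp: mem_box abs_le_iff)
      qed
    qed
  next
    fix x assume x: "x \<in> L"
    define y where "y = (\<Sum>i\<in>Basis. \<bar>x \<bullet> i\<bar> *\<^sub>R i)"
    have yi: "y \<bullet> i = \<bar>x \<bullet> i\<bar>" if "i \<in> Basis" for i using that by (simp add: y_def)
    have yL: "y \<in> L" by (rule unconditional_flip[OF L x]) (simp add: yi)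
    \<comment> \<open>Moving from \<open>a\<close> towards \<open>y\<close> by the fraction
      \<open>t\<close> stays in \<open>L\<close> and multiplies the \<open>i\<close>-th side by
      \<open>1 + t * (y \<bullet> i / (a \<bullet> i) - 1)\<close>; maximality bounds the product of
      these factors by 1.\<close>
    have "(\<Sum>i\<in>Basis. y \<bullet> i / (a \<bullet> i) - 1) \<le> 0"
    proof (rule sum_nonpos_of_prod_le_1)
      fix t :: real assume t: "0 \<le> t" "t \<le> 1"
      have "(1 - t) *\<^sub>R a + t *\<^sub>R y \<in> L" using convexD[OF conv(2) aL yL, of "1 - t" t] t by simp
      from a0(2)[OF this] fa have le: "?f ((1 - t) *\<^sub>R a + t *\<^sub>R y) \<le> ?f a" by simp
      have "?f ((1 - t) *\<^sub>R a + t *\<^sub>R y) = (\<Prod>i\<in>Basis. (1 + t * (y \<bullet> i / (a \<bullet> i) - 1)) * \<bar>a \<bullet> i\<bar>)"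
      proof (intro prod.cong refl)
        fix i :: 'a assume i: "i \<in> Basis"
        have "((1 - t) *\<^sub>R a + t *\<^sub>R y) \<bullet> i = (1 + t * (y \<bullet> i / (a \<bullet> i) - 1)) * (a \<bullet> i)"
          using apos[OF i] by (simp only: inner_add_left inner_scaleR_left) (simp add: field_simps)
        moreover have "((1 - t) *\<^sub>R a + t *\<^sub>R y) \<bullet> i \<ge> 0"
          using apos[OF i] yi[OF i] t by (simp add: inner_add_left)
        ultimately show "\<bar>((1 - t) *\<^sub>R a + t *\<^sub>R y) \<bullet> i\<bar> = (1 + t * (y \<bullet> i / (a \<bullet> i) - 1)) * \<bar>a \<bullet> i\<bar>"
          using apos[OF i] by simp
      qed
      also have "\<dots> = (\<Prod>i\<in>Basis. 1 + t * (y \<bullet> i / (a \<bullet> i) - 1)) * ?f a" by (simp add: prod.distrib)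
      finally show "(\<Prod>i\<in>Basis. 1 + t * (y \<bullet> i / (a \<bullet> i) - 1)) \<le> 1"
        using le \<open>?f a > 0\<close> mult_le_cancel_right[of "\<Prod>i\<in>Basis. 1 + t * (y \<bullet> i / (a \<bullet> i) - 1)" "?f a" 1]
        by linarith
    qed simp
    then have "(\<Sum>i\<in>Basis. y \<bullet> i / (a \<bullet> i)) \<le> DIM('a)" by (simp add: sum_subtractf)
    then show "(\<Sum>i\<in>Basis. \<bar>x \<bullet> i\<bar> / (a \<bullet> i)) \<le> DIM('a)" by (simp add: yi)
  qed
qed

section \<open>Volume of weighted cross-polytopes\<close>

lemma nn_integral_laplace:
  assumes "a > 0"
  shows "(\<integral>\<^sup>+x. ennreal (exp (- (\<bar>x\<bar> / a))) \<partial>lborel) = ennreal (2 * a)"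
proof -
  let ?h = "\<lambda>x::real. ennreal (exp (- (x / a))) * indicator {0..} x"
  have I: "(\<integral>\<^sup>+x. ?h x \<partial>lborel) = ennreal (0 - (- a * exp (- (0 / a))))"
  proof (rule nn_integral_FTC_atLeast)
    show "((\<lambda>x. - a * exp (- (x / a))) has_real_derivative exp (- (x / a))) (at x)" for x
      using assms by (auto intro!: derivative_eq_intros)
    have "((\<lambda>x. exp (- (x / a))) \<longlongrightarrow> 0) at_top"
      using filterlim_compose[OF exp_at_bot filterlim_tendsto_neg_mult_at_bot[OF tendsto_const _ filterlim_ident, of "- 1 / a"]] assms
      by simp
    from tendsto_mult_right_zero[OF this, of "- a"] show "((\<lambda>x. - a * exp (- (x / a))) \<longlongrightarrow> 0) at_top" by simp
  qed auto
  have "(\<integral>\<^sup>+x. ennreal (exp (- (\<bar>x\<bar> / a))) \<partial>lborel) = (\<integral>\<^sup>+x. ?h x + ?h (- x) \<partial>lborel)"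
  proof (rule nn_integral_cong_AE)
    have "AE x in lborel. x \<noteq> (0::real)" by (rule AE_lborel_singleton)
    then show "AE x in lborel. ennreal (exp (- (\<bar>x\<bar> / a))) = ?h x + ?h (- x)"
      by eventually_elim (auto simp: indicator_def)
  qed
  also have "\<dots> = (\<integral>\<^sup>+x. ?h x \<partial>lborel) + (\<integral>\<^sup>+x. ?h (- x) \<partial>lborel)"
    by (rule nn_integral_add) auto
  also have "(\<integral>\<^sup>+x. ?h (- x) \<partial>lborel) = (\<integral>\<^sup>+x. ?h x \<partial>lborel)"
    using nn_integral_real_affine[of ?h "-1" 0] by simp
  finally show ?thesis using assms by (simp add: I ennreal_plus[symmetric] del: ennreal_plus)
qed

text \<open>The product on the right is the volume of \<open>cbox (- a) a\<close>, since the Laplace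
  integral of scale \<open>a \<bullet> i\<close> equals the \<open>i\<close>-th side. Scaling
  \<open>a\<close> and \<open>R\<close> inversely describes the same set; among these descriptions
  the bound is least when \<open>R\<close> is the dimension, the value used later.\<close>

lemma emeasure_weighted_l1_ball_le:
  fixes a :: "'a::euclidean_space"
  assumes a: "\<And>i. i \<in> Basis \<Longrightarrow> a \<bullet> i > 0"
  shows "emeasure lborel {x. (\<Sum>i\<in>Basis. \<bar>x \<bullet> i\<bar> / (a \<bullet> i)) \<le> R} \<le> ennreal (exp R * (\<Prod>i\<in>Basis. 2 * (a \<bullet> i)))"
proof -
  let ?N = "\<lambda>x::'a. \<Sum>i\<in>Basis. \<bar>x \<bullet> i\<bar> / (a \<bullet> i)"
  have "emeasure lborel {x. ?N x \<le> R} = (\<integral>\<^sup>+x. indicator {x. ?N x \<le> R} x \<partial>lborel)"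
    by simp
  also have "\<dots> \<le> (\<integral>\<^sup>+x. ennreal (exp R) * (\<Prod>i\<in>Basis. ennreal (exp (- (\<bar>x \<bullet> i\<bar> / (a \<bullet> i))))) \<partial>lborel)"
  proof (intro nn_integral_mono)
    fix x :: 'a
    have "ennreal (exp R) * (\<Prod>i\<in>Basis. ennreal (exp (- (\<bar>x \<bullet> i\<bar> / (a \<bullet> i))))) = ennreal (exp (R - ?N x))"
      by (simp add: prod_ennreal exp_sum[symmetric] sum_negf ennreal_mult[symmetric] mult_exp_exp)
    then show "indicator {x. ?N x \<le> R} x \<le> ennreal (exp R) * (\<Prod>i\<in>Basis. ennreal (exp (- (\<bar>x \<bullet> i\<bar> / (a \<bullet> i)))))"
      by (auto simp: indicator_def)
  qed
  also have "\<dots> = ennreal (exp R) * (\<integral>\<^sup>+x. (\<Prod>i\<in>Basis. ennreal (exp (- (\<bar>x \<bullet> i\<bar> / (a \<bullet> i))))) \<partial>lborel)"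
    by (rule nn_integral_cmult) measurable
  also have "(\<integral>\<^sup>+x. (\<Prod>i\<in>Basis. ennreal (exp (- (\<bar>x \<bullet> i\<bar> / (a \<bullet> i))))) \<partial>lborel)
     = (\<Prod>i\<in>Basis. \<integral>\<^sup>+x. ennreal (exp (- (\<bar>x\<bar> / (a \<bullet> i)))) \<partial>lborel)"
    by (rule nn_integral_lborel_prod) auto
  also have "\<dots> = (\<Prod>i\<in>Basis. ennreal (2 * (a \<bullet> i)))"
    by (intro prod.cong refl nn_integral_laplace a)
  also have "\<dots> = ennreal (\<Prod>i\<in>Basis. 2 * (a \<bullet> i))"
    using a by (intro prod_ennreal) (auto intro: less_imp_le)
  finally show ?thesis
    using a by (simp add: ennreal_mult prod_nonneg less_imp_le)
qed

section \<open>Negative powers of a gauge\<close>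

lemma nn_integral_power_tail:
  assumes "0 < k" "(0::real) < y"
  shows "(\<integral>\<^sup>+r. ennreal (real k / r ^ (k+1)) * indicator {y..} r \<partial>lborel) = ennreal (1 / y ^ k)"
proof -
  have "(\<integral>\<^sup>+r. ennreal (real k / r ^ (k+1)) * indicator {y..} r \<partial>lborel) = ennreal (0 - (- (1 / y ^ k)))"
  proof (rule nn_integral_FTC_atLeast)
    fix x :: real assume "y \<le> x"
    then have x: "x > 0" using assms by simp
    have "x * x ^ (k - Suc 0) = x ^ k" using assms by (cases k) auto
    then show "((\<lambda>x. - (1 / x ^ k)) has_real_derivative real k / x ^ (k+1)) (at x)"
      using x assms by (auto intro!: derivative_eq_intros simp: field_simps)
    show "0 \<le> real k / x ^ (k+1)" using x by simp
  next
    have "filterlim (\<lambda>x::real. x ^ k) at_top at_top"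
      using assms by (intro filterlim_pow_at_top filterlim_ident) auto
    then have "((\<lambda>x::real. inverse (x ^ k)) \<longlongrightarrow> 0) at_top"
      by (rule filterlim_compose[OF tendsto_inverse_0_at_top[OF filterlim_ident]])
    from tendsto_minus[OF this] show "((\<lambda>x::real. - (1 / x ^ k)) \<longlongrightarrow> 0) at_top"
      by (simp add: divide_inverse)
  qed auto
  then show ?thesis by simp
qed

text \<open>The layer cake formula
  \<open>N\<^sup>-\<^sup>k = \<integral>\<^sub>0\<^sup>\<infinity> k r\<^sup>-\<^sup>k\<^sup>-\<^sup>1 1[N \<le> r] dr\<close> is split at the radius \<open>r0\<close>
  for which \<open>V r0\<^sup>n\<close> equals the measure of \<open>B\<close>.\<close>
lemma nn_integral_negative_power_le:
  fixes N :: "'a::euclidean_space \<Rightarrow> real" and \<beta> V :: real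
  assumes [measurable]: "N \<in> borel_measurable borel" "B \<in> sets borel"
    and N: "\<And>x. N x \<ge> 0" and B: "emeasure lborel B = ennreal \<beta>" "\<beta> > 0" and V: "V > 0"
    and level: "\<And>r. r > 0 \<Longrightarrow> emeasure lborel {x. N x \<le> r} \<le> ennreal (V * r ^ n)"
    and k: "0 < k" "k < n"
  shows "(\<integral>\<^sup>+x. indicator B x * ennreal (1 / N x ^ k) \<partial>lborel)
    \<le> ennreal (real n / (real n - real k) * \<beta> powr ((real n - real k) / real n) * V powr (real k / real n))"
proof -
  let ?w = "\<lambda>r::real. ennreal (real k / r ^ (k+1))"
  define r0 where "r0 = (\<beta> / V) powr (1 / real n)"
  have r0: "r0 > 0" using B V by (simp add: r0_def)
  have n: "n > 0" using k by simp
  have pow: "r0 ^ n = \<beta> / V"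
    using B V n by (simp add: r0_def powr_realpow[symmetric] powr_powr)
  \<comment> \<open>Only an inequality: where \<open>N x = 0\<close> the left side is 0 because
    \<open>1 / 0 = 0\<close>.\<close>
  have *: "indicator B x * ennreal (1 / N x ^ k)
      \<le> (\<integral>\<^sup>+r. indicator B x * (?w r * indicator {0<..} r * indicator {x. N x \<le> r} x) \<partial>lborel)" for x
  proof (cases "N x = 0")
    case True then show ?thesis using k by (simp add: power_0_left)
  next
    case False
    then have "N x > 0" using N[of x] by simp
    then have "ennreal (1 / N x ^ k) = (\<integral>\<^sup>+r. ?w r * indicator {N x..} r \<partial>lborel)"
      using nn_integral_power_tail k by simp
    also have "\<dots> = (\<integral>\<^sup>+r. ?w r * indicator {0<..} r * indicator {x. N x \<le> r} x \<partial>lborel)"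
      using \<open>N x > 0\<close> by (intro nn_integral_cong) (auto simp: indicator_def)
    finally show ?thesis by (simp add: nn_integral_cmult[symmetric])
  qed
  have "(\<integral>\<^sup>+x. indicator B x * ennreal (1 / N x ^ k) \<partial>lborel)
      \<le> (\<integral>\<^sup>+x. \<integral>\<^sup>+r. indicator B x * (?w r * indicator {0<..} r * indicator {x. N x \<le> r} x) \<partial>lborel \<partial>lborel)"
    by (intro nn_integral_mono *)
  also have "\<dots> = (\<integral>\<^sup>+r. \<integral>\<^sup>+x. indicator B x * (?w r * indicator {0<..} r * indicator {x. N x \<le> r} x) \<partial>lborel \<partial>lborel)"
    by (rule lborel_pair.Fubini') measurable
  \<comment> \<open>Up to \<open>r0\<close> the level-set bound \<open>V * r ^ n\<close> is used,
    beyond it the measure of \<open>B\<close>. Both ranges contain \<open>r0\<close>, which does no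
    harm in an upper bound.\<close>
  also have "\<dots> \<le> (\<integral>\<^sup>+r. ennreal (real k * V * r ^ (n - k - 1)) * indicator {0..r0} r
       + ennreal \<beta> * (?w r * indicator {r0..} r) \<partial>lborel)"
  proof (rule nn_integral_mono)
    fix r :: real
    have eq: "(\<integral>\<^sup>+x. indicator B x * (?w r * indicator {0<..} r * indicator {x. N x \<le> r} x) \<partial>lborel)
      = ?w r * indicator {0<..} r * emeasure lborel (B \<inter> {x. N x \<le> r})"
      by (subst nn_integral_indicator[symmetric], measurable, subst nn_integral_cmult[symmetric], measurable)
         (auto intro!: nn_integral_cong simp: indicator_def)
    show "(\<integral>\<^sup>+x. indicator B x * (?w r * indicator {0<..} r * indicator {x. N x \<le> r} x) \<partial>lborel)
      \<le> ennreal (real k * V * r ^ (n - k - 1)) * indicator {0..r0} r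
       + ennreal \<beta> * (?w r * indicator {r0..} r)"
    proof (cases "0 < r")
      case False then show ?thesis unfolding eq by simp
    next
      case r: True
      show ?thesis
      proof (cases "r \<le> r0")
        case True
        have "emeasure lborel (B \<inter> {x. N x \<le> r}) \<le> emeasure lborel {x. N x \<le> r}"
          by (rule emeasure_mono) auto
        also have "\<dots> \<le> ennreal (V * r ^ n)" by (rule level[OF r])
        finally have "?w r * emeasure lborel (B \<inter> {x. N x \<le> r}) \<le> ?w r * ennreal (V * r ^ n)"
          by (rule mult_left_mono) simp
        also have "\<dots> = ennreal (real k / r ^ (k+1) * (V * r ^ n))"
          using r V by (intro ennreal_mult[symmetric]) auto
        also have "real k / r ^ (k+1) * (V * r ^ n) = real k * V * (r ^ n / r ^ (k + 1))" by simp
        also have "r ^ n / r ^ (k + 1) = r ^ (n - k - 1)"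
          using r k by (subst power_diff[symmetric]) auto
        finally show ?thesis unfolding eq using r True by (simp add: add_increasing2)
      next
        case False
        have "emeasure lborel (B \<inter> {x. N x \<le> r}) \<le> ennreal \<beta>"
          unfolding B(1)[symmetric] by (rule emeasure_mono) auto
        then have "?w r * emeasure lborel (B \<inter> {x. N x \<le> r}) \<le> ?w r * ennreal \<beta>"
          by (rule mult_left_mono) simp
        then show ?thesis unfolding eq using r False by (simp add: mult_ac)
      qed
    qed
  qed
  also have "\<dots> = (\<integral>\<^sup>+r. ennreal (real k * V * r ^ (n - k - 1)) * indicator {0..r0} r \<partial>lborel)
       + (\<integral>\<^sup>+r. ennreal \<beta> * (?w r * indicator {r0..} r) \<partial>lborel)"
    by (rule nn_integral_add) auto
  also have "(\<integral>\<^sup>+r. ennreal (real k * V * r ^ (n - k - 1)) * indicator {0..r0} r \<partial>lborel)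
    = ennreal (real k * V / real (n - k) * r0 ^ (n - k) - real k * V / real (n - k) * 0 ^ (n - k))"
  proof (rule nn_integral_FTC_Icc)
    fix x :: real assume "x \<in> {0..r0}"
    then show "0 \<le> real k * V * x ^ (n - k - 1)" using V by simp
    show "((\<lambda>r. real k * V / real (n - k) * r ^ (n - k)) has_real_derivative real k * V * x ^ (n - k - 1)) (at x)"
      using k by (auto intro!: derivative_eq_intros)
  qed (use r0 in auto)
  also have "(\<integral>\<^sup>+r. ennreal \<beta> * (?w r * indicator {r0..} r) \<partial>lborel) = ennreal \<beta> * ennreal (1 / r0 ^ k)"
    by (subst nn_integral_cmult) (use nn_integral_power_tail[OF k(1) r0] in auto)
  also have "ennreal (real k * V / real (n - k) * r0 ^ (n - k) - real k * V / real (n - k) * 0 ^ (n - k)) +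
      ennreal \<beta> * ennreal (1 / r0 ^ k) = ennreal (real k * V / real (n - k) * r0 ^ (n - k) + \<beta> / r0 ^ k)"
    using k V B r0 by (subst ennreal_plus) (auto simp: ennreal_mult[symmetric] power_0_left)
  \<comment> \<open>By the choice of \<open>r0\<close>,
    \<open>V * r0 ^ (n - k) = \<beta> / r0 ^ k\<close>, so the two parts combine with the
    coefficient \<open>k / (n - k) + 1 = n / (n - k)\<close>.\<close>
  also have "real k * V / real (n - k) * r0 ^ (n - k) + \<beta> / r0 ^ k
     = real n / (real n - real k) * \<beta> powr ((real n - real k) / real n) * V powr (real k / real n)"
  proof -
    have "r0 ^ (n - k) = \<beta> / V / r0 ^ k"
      using k r0 pow by (simp add: power_diff)
    moreover have "\<beta> / r0 ^ k = \<beta> powr ((real n - real k) / real n) * V powr (real k / real n)"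
    proof -
      have "r0 ^ k = (\<beta> / V) powr (real k / real n)"
        using B V by (simp add: r0_def powr_realpow[symmetric] powr_powr)
      moreover have "(real n - real k) / real n = 1 - real k / real n" using n by (simp add: field_simps)
      ultimately show ?thesis using B V by (simp add: powr_divide powr_diff)
    qed
    moreover have "real k * V / real (n - k) * (\<beta> / V / r0 ^ k) + \<beta> / r0 ^ k
       = real n / (real n - real k) * (\<beta> / r0 ^ k)"
      using k V r0 by (simp add: field_simps of_nat_diff)
    ultimately show ?thesis by simp
  qed
  finally show ?thesis .
qed

section \<open>Cauchy densities\<close>

interpretation lborel_product: product_sigma_finite "\<lambda>_::'i. lborel :: real measure"
  by unfold_locales

lemma nn_integral_FTC_whole_line:
  fixes f F :: "real \<Rightarrow> real"
  assumes [measurable]: "f \<in> borel_measurable borel"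
    and F: "\<And>x. (F has_real_derivative f x) (at x)" and f: "\<And>x. f x \<ge> 0"
    and top: "(F \<longlongrightarrow> T) at_top" and bot: "(F \<longlongrightarrow> S) at_bot"
  shows "(\<integral>\<^sup>+x. ennreal (f x) \<partial>lborel) = ennreal (T - S)"
proof -
  have mono: "F x \<le> F y" if "x \<le> y" for x y
    using that F f by (intro DERIV_nonneg_imp_nondecreasing[of x y F]) auto
  \<comment> \<open>\<open>ennreal\<close> truncates negative numbers, so the values on the two
    half-lines can be added only once both are known to be nonnegative.\<close>
  have T: "F 0 \<le> T"
    by (rule tendsto_lowerbound[OF top]) (auto intro!: eventually_mono[OF eventually_ge_at_top[of 0]] mono)
  have S: "S \<le> F 0"
    by (rule tendsto_upperbound[OF bot]) (auto intro!: eventually_mono[OF eventually_le_at_bot[of 0]] mono)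
  have pos: "(\<integral>\<^sup>+x. ennreal (f x) * indicator {0..} x \<partial>lborel) = ennreal (T - F 0)"
    by (rule nn_integral_FTC_atLeast) (auto intro: F f top)
  have neg: "(\<integral>\<^sup>+x. ennreal (f (- x)) * indicator {0..} x \<partial>lborel) = ennreal (- S - - F (- 0))"
  proof (rule nn_integral_FTC_atLeast)
    show "((\<lambda>x. - F (- x)) has_real_derivative f (- x)) (at x)" for x
      using F[of "- x"] by (auto intro!: derivative_eq_intros DERIV_chain2[where f = F])
    show "((\<lambda>x. - F (- x)) \<longlongrightarrow> - S) at_top"
      by (intro tendsto_minus filterlim_compose[OF bot] filterlim_uminus_at_bot_at_top)
  qed (auto intro: f)
  have "(\<integral>\<^sup>+x. ennreal (f x) \<partial>lborel)
      = (\<integral>\<^sup>+x. ennreal (f x) * indicator {0..} x + ennreal (f x) * indicator {0..} (- x) \<partial>lborel)"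
  proof (rule nn_integral_cong_AE)
    have "AE x in lborel. x \<noteq> (0::real)" by (rule AE_lborel_singleton)
    then show "AE x in lborel. ennreal (f x) = ennreal (f x) * indicator {0..} x + ennreal (f x) * indicator {0..} (- x)"
      by eventually_elim (auto simp: indicator_def)
  qed
  also have "\<dots> = (\<integral>\<^sup>+x. ennreal (f x) * indicator {0..} x \<partial>lborel) + (\<integral>\<^sup>+x. ennreal (f x) * indicator {0..} (- x) \<partial>lborel)"
    by (rule nn_integral_add) auto
  also have "(\<integral>\<^sup>+x. ennreal (f x) * indicator {0..} (- x) \<partial>lborel) = (\<integral>\<^sup>+x. ennreal (f (- x)) * indicator {0..} x \<partial>lborel)"
    using nn_integral_real_affine[of "\<lambda>x. ennreal (f x) * indicator {0..} (- x)" "-1" 0] by simp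
  finally show ?thesis unfolding pos neg using T S by (simp add: ennreal_plus[symmetric] del: ennreal_plus)
qed

definition cauchy_density :: "real \<Rightarrow> real \<Rightarrow> real" where
  "cauchy_density \<alpha> u = \<alpha> / (pi * (\<alpha>\<^sup>2 + u\<^sup>2))"

lemma cauchy_density_nonneg: "\<alpha> \<ge> 0 \<Longrightarrow> cauchy_density \<alpha> u \<ge> 0"
  by (simp add: cauchy_density_def)

lemma borel_measurable_cauchy_density [measurable (raw)]:
  assumes "f \<in> borel_measurable M" "g \<in> borel_measurable M"
  shows "(\<lambda>x. cauchy_density (f x) (g x)) \<in> borel_measurable M"
  unfolding cauchy_density_def using assms by measurable

lemma nn_integral_cauchy_density:
  "(\<integral>\<^sup>+v. ennreal (cauchy_density 1 v) \<partial>lborel) = 1"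
proof -
  have "(\<integral>\<^sup>+v. ennreal (cauchy_density 1 v) \<partial>lborel) = ennreal (1 / 2 - - 1 / 2)"
  proof (rule nn_integral_FTC_whole_line)
    show "((\<lambda>v. arctan v / pi) has_real_derivative cauchy_density 1 v) (at v)" for v
      using DERIV_cdivide[OF DERIV_arctan, of pi v] by (simp add: cauchy_density_def divide_simps mult.commute)
    show "((\<lambda>v. arctan v / pi) \<longlongrightarrow> 1 / 2) at_top" by real_asymp
    show "((\<lambda>v. arctan v / pi) \<longlongrightarrow> - 1 / 2) at_bot" by real_asymp
  qed (auto simp: cauchy_density_def)
  then show ?thesis by simp
qed

lemma DERIV_arctan_affine:
  fixes \<delta> :: real
  assumes "\<delta> > 0"
  shows "((\<lambda>v. arctan ((v + w) / \<delta>)) has_real_derivative \<delta> / ((v + w)\<^sup>2 + \<delta>\<^sup>2)) (at v)"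
  using assms by (auto intro!: derivative_eq_intros simp: power2_eq_square field_simps add_pos_nonneg)

text \<open>Stability of the Cauchy family under addition, obtained from an explicit antiderivative
  and its limits at both ends.\<close>

lemma cauchy_convolution:
  assumes \<alpha>: "\<alpha> > 0" and \<gamma>: "\<gamma> > 0"
  shows "(\<integral>\<^sup>+v. ennreal (cauchy_density \<alpha> (u + v) * cauchy_density \<gamma> v) \<partial>lborel)
     = ennreal (cauchy_density (\<alpha> + \<gamma>) u)"
proof (cases "u = 0 \<and> \<alpha> = \<gamma>")
  \<comment> \<open>Here the two quadratic denominators coincide and the quantity \<open>D\<close>
    of the other case vanishes, so the squared denominator gets its own antiderivative.\<close>
  case True
  let ?F = "\<lambda>v. (v / (2 * (v\<^sup>2 + \<alpha>\<^sup>2)) + arctan (v / \<alpha>) / (2 * \<alpha>)) / pi\<^sup>2"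
  have "(\<integral>\<^sup>+v. ennreal (cauchy_density \<alpha> (u + v) * cauchy_density \<gamma> v) \<partial>lborel)
     = ennreal (1 / (4 * \<alpha> * pi) - - 1 / (4 * \<alpha> * pi))"
  proof (rule nn_integral_FTC_whole_line)
    fix v :: real
    have pos: "v\<^sup>2 + \<alpha>\<^sup>2 > 0" using \<alpha> by (simp add: add_nonneg_pos)
    have "((\<lambda>v. v / (2 * (v\<^sup>2 + \<alpha>\<^sup>2))) has_real_derivative
       (1 * (2 * (v\<^sup>2 + \<alpha>\<^sup>2)) - v * (2 * (2 * v))) / (2 * (v\<^sup>2 + \<alpha>\<^sup>2) * (2 * (v\<^sup>2 + \<alpha>\<^sup>2)))) (at v)"
      using pos by (auto intro!: derivative_eq_intros)
    moreover have "((\<lambda>v. arctan (v / \<alpha>) / (2 * \<alpha>)) has_real_derivative \<alpha> / (v\<^sup>2 + \<alpha>\<^sup>2) / (2 * \<alpha>)) (at v)"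
      by (rule DERIV_cdivide) (use DERIV_arctan_affine[OF \<alpha>, of 0 v] in simp)
    ultimately have "((\<lambda>v. v / (2 * (v\<^sup>2 + \<alpha>\<^sup>2)) + arctan (v / \<alpha>) / (2 * \<alpha>)) has_real_derivative
       (1 * (2 * (v\<^sup>2 + \<alpha>\<^sup>2)) - v * (2 * (2 * v))) / (2 * (v\<^sup>2 + \<alpha>\<^sup>2) * (2 * (v\<^sup>2 + \<alpha>\<^sup>2)))
       + \<alpha> / (v\<^sup>2 + \<alpha>\<^sup>2) / (2 * \<alpha>)) (at v)"
      by (rule DERIV_add)
    also have "(1 * (2 * (v\<^sup>2 + \<alpha>\<^sup>2)) - v * (2 * (2 * v))) / (2 * (v\<^sup>2 + \<alpha>\<^sup>2) * (2 * (v\<^sup>2 + \<alpha>\<^sup>2)))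
       + \<alpha> / (v\<^sup>2 + \<alpha>\<^sup>2) / (2 * \<alpha>) = \<alpha>\<^sup>2 / (v\<^sup>2 + \<alpha>\<^sup>2)\<^sup>2"
      using pos \<alpha> by (simp add: divide_simps) (simp add: power2_eq_square algebra_simps)
    finally have "(?F has_real_derivative \<alpha>\<^sup>2 / (v\<^sup>2 + \<alpha>\<^sup>2)\<^sup>2 / pi\<^sup>2) (at v)"
      by (rule DERIV_cdivide)
    then show "(?F has_real_derivative cauchy_density \<alpha> (u + v) * cauchy_density \<gamma> v) (at v)"
      using True by (simp add: cauchy_density_def power2_eq_square mult_ac add_ac)
    show "0 \<le> cauchy_density \<alpha> (u + v) * cauchy_density \<gamma> v"
      using \<alpha> \<gamma> by (simp add: cauchy_density_nonneg)
  next
    show "(?F \<longlongrightarrow> 1 / (4 * \<alpha> * pi)) at_top"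
      using \<alpha> by (real_asymp simp: power2_eq_square field_simps)
    show "(?F \<longlongrightarrow> - 1 / (4 * \<alpha> * pi)) at_bot"
      using \<alpha> by (real_asymp simp: power2_eq_square field_simps)
  qed measurable
  also have "1 / (4 * \<alpha> * pi) - - 1 / (4 * \<alpha> * pi) = cauchy_density (\<alpha> + \<gamma>) u"
    using \<alpha> True by (simp add: cauchy_density_def field_simps power2_eq_square)
  finally show ?thesis .
next
  case False
  define D where "D = (u\<^sup>2 + (\<alpha> + \<gamma>)\<^sup>2) * (u\<^sup>2 + (\<alpha> - \<gamma>)\<^sup>2)"
  have D1: "u\<^sup>2 + (\<alpha> + \<gamma>)\<^sup>2 > 0" using \<alpha> \<gamma> by (simp add: add_nonneg_pos)
  have D2: "u\<^sup>2 + (\<alpha> - \<gamma>)\<^sup>2 > 0" using False by (auto simp: sum_power2_gt_zero_iff)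
  have D: "D > 0" using D1 D2 by (simp add: D_def)
  \<comment> \<open>Partial fractions:
    \<open>1 / (P * Q) = (A * v + B) / P + (C - A * (v + u)) / Q\<close> for the quadratics
    \<open>P\<close>, \<open>Q\<close> below. The opposite \<open>A\<close> terms integrate to a
    difference of logarithms that tends to 0 at both ends.\<close>
  define A B C where "A = - 2 * u / D" and "B = (u\<^sup>2 + \<alpha>\<^sup>2 - \<gamma>\<^sup>2) / D" and "C = (u\<^sup>2 + \<gamma>\<^sup>2 - \<alpha>\<^sup>2) / D"
  let ?L = "\<lambda>v. A / 2 * (ln (v\<^sup>2 + \<gamma>\<^sup>2) - ln ((v + u)\<^sup>2 + \<alpha>\<^sup>2))"
  let ?F = "\<lambda>v. \<alpha> * \<gamma> / pi\<^sup>2 * (?L v + B / \<gamma> * arctan (v / \<gamma>) + C / \<alpha> * arctan ((v + u) / \<alpha>))"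
  let ?T = "\<alpha> * \<gamma> / pi\<^sup>2 * (B / \<gamma> * (pi / 2) + C / \<alpha> * (pi / 2))"
  have "(\<integral>\<^sup>+v. ennreal (cauchy_density \<alpha> (u + v) * cauchy_density \<gamma> v) \<partial>lborel) = ennreal (?T - - ?T)"
  proof (rule nn_integral_FTC_whole_line)
    fix v :: real
    define P Q where "P = v\<^sup>2 + \<gamma>\<^sup>2" and "Q = (v + u)\<^sup>2 + \<alpha>\<^sup>2"
    have pos: "P > 0" "Q > 0" using \<alpha> \<gamma> by (auto simp: P_def Q_def add_nonneg_pos)
    have "(?F has_real_derivative \<alpha> * \<gamma> / pi\<^sup>2 * (A / 2 * (2 * v / P - 2 * (v + u) / Q)
        + B / \<gamma> * (\<gamma> / P) + C / \<alpha> * (\<alpha> / Q))) (at v)"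
      using pos DERIV_arctan_affine[OF \<gamma>, of 0] DERIV_arctan_affine[OF \<alpha>, of u] unfolding P_def Q_def
      by (intro DERIV_cmult DERIV_add DERIV_diff) (auto intro!: derivative_eq_intros)
    also have "A / 2 * (2 * v / P - 2 * (v + u) / Q) + B / \<gamma> * (\<gamma> / P) + C / \<alpha> * (\<alpha> / Q)
       = ((A * v + B) * Q + (C - A * (v + u)) * P) / (P * Q)"
      using pos \<alpha> \<gamma> by (simp add: field_simps)
    also have "(A * v + B) * Q + (C - A * (v + u)) * P =
       ((- 2 * u * v + (u\<^sup>2 + \<alpha>\<^sup>2 - \<gamma>\<^sup>2)) * Q + ((u\<^sup>2 + \<gamma>\<^sup>2 - \<alpha>\<^sup>2) + 2 * u * (v + u)) * P) / D"
      using D by (simp add: A_def B_def C_def field_simps)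
    also have "(- 2 * u * v + (u\<^sup>2 + \<alpha>\<^sup>2 - \<gamma>\<^sup>2)) * Q + ((u\<^sup>2 + \<gamma>\<^sup>2 - \<alpha>\<^sup>2) + 2 * u * (v + u)) * P = D"
      unfolding D_def P_def Q_def by algebra
    also have "D / D = 1" using D by simp
    finally show "(?F has_real_derivative cauchy_density \<alpha> (u + v) * cauchy_density \<gamma> v) (at v)"
      by (simp add: cauchy_density_def P_def Q_def power2_eq_square[of pi] mult_ac add_ac)
    show "0 \<le> cauchy_density \<alpha> (u + v) * cauchy_density \<gamma> v"
      using \<alpha> \<gamma> by (simp add: cauchy_density_nonneg)
  next
    have L: "(?L \<longlongrightarrow> A / 2 * 0) at_top" "(?L \<longlongrightarrow> A / 2 * 0) at_bot"
      by (intro tendsto_mult tendsto_const; real_asymp)+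
    have t: "((\<lambda>v. arctan ((v + w) / \<delta>)) \<longlongrightarrow> pi / 2) at_top" "((\<lambda>v. arctan ((v + w) / \<delta>)) \<longlongrightarrow> - (pi / 2)) at_bot"
      if "\<delta> > 0" for w \<delta> :: real
      using that by real_asymp+
    have "(?F \<longlongrightarrow> \<alpha> * \<gamma> / pi\<^sup>2 * (A / 2 * 0 + B / \<gamma> * (pi / 2) + C / \<alpha> * (pi / 2))) at_top"
      using t(1)[OF \<gamma>, of 0] t(1)[OF \<alpha>, of u] by (intro tendsto_mult tendsto_add tendsto_const L) auto
    then show "(?F \<longlongrightarrow> ?T) at_top" by simp
    have "(?F \<longlongrightarrow> \<alpha> * \<gamma> / pi\<^sup>2 * (A / 2 * 0 + B / \<gamma> * (- (pi / 2)) + C / \<alpha> * (- (pi / 2)))) at_bot"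
      using t(2)[OF \<gamma>, of 0] t(2)[OF \<alpha>, of u] by (intro tendsto_mult tendsto_add tendsto_const L) auto
    also have "\<alpha> * \<gamma> / pi\<^sup>2 * (A / 2 * 0 + B / \<gamma> * (- (pi / 2)) + C / \<alpha> * (- (pi / 2))) = - ?T"
      by (simp only: mult_zero_right add_0 mult_minus_right minus_add_distrib[symmetric])
    finally show "(?F \<longlongrightarrow> - ?T) at_bot" .
  qed measurable
  also have "?T - - ?T = (\<alpha> * B + \<gamma> * C) / pi"
    using \<alpha> \<gamma> by (simp add: field_simps power2_eq_square)
  also have "\<alpha> * B + \<gamma> * C = (\<alpha> * (u\<^sup>2 + \<alpha>\<^sup>2 - \<gamma>\<^sup>2) + \<gamma> * (u\<^sup>2 + \<gamma>\<^sup>2 - \<alpha>\<^sup>2)) / D"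
    by (simp add: B_def C_def add_divide_distrib)
  also have "\<alpha> * (u\<^sup>2 + \<alpha>\<^sup>2 - \<gamma>\<^sup>2) + \<gamma> * (u\<^sup>2 + \<gamma>\<^sup>2 - \<alpha>\<^sup>2) = (\<alpha> + \<gamma>) * (u\<^sup>2 + (\<alpha> - \<gamma>)\<^sup>2)"
    by algebra
  also have "(\<alpha> + \<gamma>) * (u\<^sup>2 + (\<alpha> - \<gamma>)\<^sup>2) / D / pi = cauchy_density (\<alpha> + \<gamma>) u"
    using D2 False by (simp add: cauchy_density_def D_def add.commute mult.commute)
  finally show ?thesis .
qed

text \<open>If \<open>y\<close> is standard Cauchy then \<open>b * y\<close> has scale
  \<open>\<bar>b\<bar>\<close>, so this is the convolution after a rescaling. The case
  \<open>b = 0\<close> stands apart because \<open>cauchy_density 0\<close> is the zero function and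
  not a point mass.\<close>

lemma cauchy_convolution_scaled:
  assumes \<alpha>: "\<alpha> > 0"
  shows "(\<integral>\<^sup>+y. ennreal (cauchy_density 1 y) * ennreal (cauchy_density \<alpha> (u + b * y)) \<partial>lborel)
     = ennreal (cauchy_density (\<alpha> + \<bar>b\<bar>) u)"
proof (cases "b = 0")
  case True
  then show ?thesis by (simp add: nn_integral_multc nn_integral_cauchy_density)
next
  case False
  have "(\<integral>\<^sup>+y. ennreal (cauchy_density 1 y) * ennreal (cauchy_density \<alpha> (u + b * y)) \<partial>lborel)
    = ennreal \<bar>1 / b\<bar> * (\<integral>\<^sup>+v. ennreal (cauchy_density 1 (0 + 1 / b * v)) * ennreal (cauchy_density \<alpha> (u + b * (0 + 1 / b * v))) \<partial>lborel)"
    by (rule nn_integral_real_affine) (use False in auto)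
  also have "\<dots> = (\<integral>\<^sup>+v. ennreal \<bar>1 / b\<bar> * (ennreal (cauchy_density 1 (0 + 1 / b * v)) * ennreal (cauchy_density \<alpha> (u + b * (0 + 1 / b * v)))) \<partial>lborel)"
    by (rule nn_integral_cmult[symmetric]) measurable
  also have "\<dots> = (\<integral>\<^sup>+v. ennreal (cauchy_density \<alpha> (u + v) * cauchy_density \<bar>b\<bar> v) \<partial>lborel)"
  proof (intro nn_integral_cong)
    fix v
    have "\<bar>1 / b\<bar> * cauchy_density 1 (1 / b * v) = cauchy_density \<bar>b\<bar> v"
    proof -
      have "b\<^sup>2 + v\<^sup>2 \<noteq> 0" using False by (simp add: sum_power2_eq_zero_iff)
      then show ?thesis using False
        by (simp add: cauchy_density_def power_mult_distrib power_divide divide_simps)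
           (simp add: power2_eq_square algebra_simps abs_if)
    qed
    moreover have "ennreal \<bar>1 / b\<bar> * (ennreal (cauchy_density 1 (1 / b * v)) * ennreal (cauchy_density \<alpha> (u + v)))
      = ennreal (cauchy_density \<alpha> (u + v) * (\<bar>1 / b\<bar> * cauchy_density 1 (1 / b * v)))"
      using \<alpha> by (simp add: ennreal_mult[symmetric] cauchy_density_nonneg mult_ac)
    ultimately show "ennreal \<bar>1 / b\<bar> * (ennreal (cauchy_density 1 (0 + 1 / b * v)) * ennreal (cauchy_density \<alpha> (u + b * (0 + 1 / b * v))))
      = ennreal (cauchy_density \<alpha> (u + v) * cauchy_density \<bar>b\<bar> v)"
      using False by simp
  qed
  also have "\<dots> = ennreal (cauchy_density (\<alpha> + \<bar>b\<bar>) u)"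
    using \<alpha> False by (intro cauchy_convolution) auto
  finally show ?thesis .
qed

text \<open>Integrating out one coordinate moves \<open>\<bar>x i\<bar>\<close> into the scale,
  hence the induction for arbitrary \<alpha>. The positive \<alpha> is the share of a coordinate
  held back; it leaves a genuine density even when all \<open>x j\<close> vanish.\<close>

lemma cauchy_mixture:
  fixes x :: "'i \<Rightarrow> real"
  assumes "finite I" "\<alpha> > 0"
  shows "(\<integral>\<^sup>+\<zeta>. (\<Prod>j\<in>I. ennreal (cauchy_density 1 (\<zeta> j))) * ennreal (cauchy_density \<alpha> (u + (\<Sum>j\<in>I. x j * \<zeta> j))) \<partial>PiM I (\<lambda>_. lborel))
    = ennreal (cauchy_density (\<alpha> + (\<Sum>j\<in>I. \<bar>x j\<bar>)) u)"
  using assms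
proof (induction I arbitrary: \<alpha> rule: finite_induct)
  case empty
  then show ?case by (simp add: PiM_empty)
next
  case (insert i I)
  have "(\<integral>\<^sup>+\<zeta>. (\<Prod>j\<in>insert i I. ennreal (cauchy_density 1 (\<zeta> j))) * ennreal (cauchy_density \<alpha> (u + (\<Sum>j\<in>insert i I. x j * \<zeta> j))) \<partial>PiM (insert i I) (\<lambda>_. lborel))
    = (\<integral>\<^sup>+\<zeta>. \<integral>\<^sup>+y. (\<Prod>j\<in>insert i I. ennreal (cauchy_density 1 ((\<zeta>(i := y)) j))) * ennreal (cauchy_density \<alpha> (u + (\<Sum>j\<in>insert i I. x j * (\<zeta>(i := y)) j))) \<partial>lborel \<partial>PiM I (\<lambda>_. lborel))"
    by (rule lborel_product.product_nn_integral_insert[OF insert.hyps(1,2)]) measurable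
  also have "\<dots> = (\<integral>\<^sup>+\<zeta>. (\<Prod>j\<in>I. ennreal (cauchy_density 1 (\<zeta> j))) * ennreal (cauchy_density (\<alpha> + \<bar>x i\<bar>) (u + (\<Sum>j\<in>I. x j * \<zeta> j))) \<partial>PiM I (\<lambda>_. lborel))"
  proof (intro nn_integral_cong)
    fix \<zeta>
    have p: "(\<Prod>j\<in>insert i I. ennreal (cauchy_density 1 ((\<zeta>(i := y)) j)))
      = (\<Prod>j\<in>I. ennreal (cauchy_density 1 (\<zeta> j))) * ennreal (cauchy_density 1 y)" for y
      using insert.hyps by (auto simp: mult.commute intro!: prod.cong arg_cong2[where f = "(*)"])
    have s: "(\<Sum>j\<in>insert i I. x j * (\<zeta>(i := y)) j) = (\<Sum>j\<in>I. x j * \<zeta> j) + x i * y" for y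
      using insert.hyps by (auto simp: add.commute intro!: sum.cong arg_cong2[where f = "(+)"])
    show "(\<integral>\<^sup>+y. (\<Prod>j\<in>insert i I. ennreal (cauchy_density 1 ((\<zeta>(i := y)) j))) * ennreal (cauchy_density \<alpha> (u + (\<Sum>j\<in>insert i I. x j * (\<zeta>(i := y)) j))) \<partial>lborel)
      = (\<Prod>j\<in>I. ennreal (cauchy_density 1 (\<zeta> j))) * ennreal (cauchy_density (\<alpha> + \<bar>x i\<bar>) (u + (\<Sum>j\<in>I. x j * \<zeta> j)))"
      unfolding p s using cauchy_convolution_scaled[OF insert.prems, of "u + (\<Sum>j\<in>I. x j * \<zeta> j)" "x i"]
      by (simp add: mult.assoc nn_integral_cmult add.assoc)
  qed
  also have "\<dots> = ennreal (cauchy_density (\<alpha> + \<bar>x i\<bar> + (\<Sum>j\<in>I. \<bar>x j\<bar>)) u)"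
    using insert.prems by (intro insert.IH) (simp add: add_pos_nonneg)
  finally show ?case using insert.hyps by (simp add: add.assoc)
qed

section \<open>Changes of variables\<close>

lemma nn_integral_indicator_UN_incseq:
  assumes [measurable]: "f \<in> borel_measurable M" "\<And>i::nat. A i \<in> sets M" and "incseq A"
  shows "(\<integral>\<^sup>+x. f x * indicator (\<Union>i. A i) x \<partial>M) = (SUP i. \<integral>\<^sup>+x. f x * indicator (A i) x \<partial>M)"
proof -
  have "(SUP i. emeasure (density M f) (A i)) = emeasure (density M f) (\<Union>i. A i)"
    by (rule SUP_emeasure_incseq) (use assms in auto)
  then show ?thesis by (simp add: emeasure_density)
qed

text \<open>The measure \<open>ds / s\<close> on the half-line is invariant under
  \<open>s \<mapsto> c / s\<close>; the substitution is done on compact intervals exhausting the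
  half-line.\<close>

lemma nn_integral_inversion_half_line:
  fixes h :: "real \<Rightarrow> ennreal" and c :: real
  assumes [measurable]: "h \<in> borel_measurable borel" and c: "c > 0"
  shows "(\<integral>\<^sup>+s. h s * ennreal (1 / \<bar>s\<bar>) * indicator {0<..} s \<partial>lborel)
       = (\<integral>\<^sup>+r. h (c / r) * ennreal (1 / \<bar>r\<bar>) * indicator {0<..} r \<partial>lborel)"
proof -
  let ?f = "\<lambda>s. h s * ennreal (1 / \<bar>s\<bar>)"
  \<comment> \<open>\<open>A n\<close> is stable under \<open>r \<mapsto> 1 / r\<close>, so
    \<open>r \<mapsto> c / r\<close> maps it onto its multiple \<open>B n\<close>. The summand 2
    keeps even the first interval nondegenerate.\<close>
  define A where "A n = {1 / (real n + 2)..(real n + 2)}" for n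
  define B where "B n = {c / (real n + 2)..c * (real n + 2)}" for n
  have fin: "(\<integral>\<^sup>+s. ?f s * indicator (B n) s \<partial>lborel)
      = (\<integral>\<^sup>+r. h (c / r) * ennreal (1 / \<bar>r\<bar>) * indicator (A n) r \<partial>lborel)" for n
  proof -
    let ?g = "\<lambda>r. - c / r" and ?a = "1 / (real n + 2)" and ?b = "real n + 2"
    have ab: "?a < ?b" by (rule less_trans[of _ 1]) auto
    have pos: "x > 0" if "x \<in> {?a..?b}" for x
    proof -
      have "0 < ?a" by simp
      also have "?a \<le> x" using that by simp
      finally show ?thesis .
    qed
    have [measurable]: "A n \<in> sets borel" "B n \<in> sets borel" by (auto simp: A_def B_def)
    \<comment> \<open>Reflecting first makes the substitution \<open>r \<mapsto> - c / r\<close>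
      increasing, with the nonnegative derivative that the substitution rule asks for.\<close>
    have "(\<integral>\<^sup>+s. ?f s * indicator (B n) s \<partial>lborel) = (\<integral>\<^sup>+s. ?f (- s) * indicator (B n) (- s) \<partial>lborel)"
      using nn_integral_real_affine[of "\<lambda>s. ?f s * indicator (B n) s" "-1" 0] by simp
    also have "\<dots> = (\<integral>\<^sup>+s. ?f (- s) * indicator {?g ?a..?g ?b} s \<partial>lborel)"
      by (intro nn_integral_cong) (auto simp: B_def indicator_def minus_divide_left[symmetric])
    also have "\<dots> = (\<integral>\<^sup>+r. ?f (- ?g r) * ennreal (c / r\<^sup>2) * indicator {?a..?b} r \<partial>lborel)"
    proof (intro nn_integral_substitution_aux)
      fix x assume "x \<in> {?a..?b}"
      then have "x > 0" by (rule pos)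
      then show "(?g has_real_derivative c / x\<^sup>2) (at x)"
        by (auto intro!: derivative_eq_intros simp: power2_eq_square)
      show "0 \<le> c / x\<^sup>2" using c by simp
    next
      show "continuous_on {?a..?b} (\<lambda>r. c / r\<^sup>2)"
        by (intro continuous_intros) (use pos in force)
    qed (use ab in auto)
    also have "\<dots> = (\<integral>\<^sup>+r. h (c / r) * ennreal (1 / \<bar>r\<bar>) * indicator (A n) r \<partial>lborel)"
    proof (intro nn_integral_cong)
      fix r
      show "?f (- ?g r) * ennreal (c / r\<^sup>2) * indicator {?a..?b} r = h (c / r) * ennreal (1 / \<bar>r\<bar>) * indicator (A n) r"
      proof (cases "r \<in> {?a..?b}")
        case True
        then have r: "r > 0" by (rule pos)
        have "ennreal (1 / \<bar>c / r\<bar>) * ennreal (c / r\<^sup>2) = ennreal (1 / \<bar>r\<bar>)"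
          using r c by (simp add: ennreal_mult[symmetric] power2_eq_square)
        then show ?thesis using True by (simp add: A_def mult.assoc)
      qed (auto simp: A_def)
    qed
    finally show ?thesis .
  qed
  have UA: "(\<Union>n. A n) = {0<..}"
  proof (intro equalityI subsetI)
    fix r :: real assume "r \<in> {0<..}"
    then have r: "r > 0" by simp
    obtain n where n: "max r (1 / r) \<le> real n" using real_arch_simple by blast
    then have "r \<le> (real n + 2)" "1 / r \<le> (real n + 2)" by auto
    then have "r \<in> A n" using r by (auto simp: A_def field_simps)
    then show "r \<in> (\<Union>n. A n)" by blast
  next
    fix r assume "r \<in> (\<Union>n. A n)"
    then obtain n where "1 / (real n + 2) \<le> r" by (auto simp: A_def)
    then show "r \<in> {0<..}" by (simp add: less_le_trans[of 0 "1 / (real n + 2)"])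
  qed
  have BA: "B n = (\<lambda>r. c * r) ` A n" for n
    using c by (simp add: A_def B_def image_mult_atLeastAtMost)
  have UB: "(\<Union>n. B n) = {0<..}"
    unfolding BA image_UN[symmetric] UA
    using c by (auto simp: image_iff intro!: bexI[of _ "_ / c"])
  have incA: "incseq A"
  proof (unfold incseq_def, intro allI impI)
    fix m n :: nat assume "m \<le> n"
    then have "1 / (real n + 2) \<le> 1 / (real m + 2)" "(real m + 2) \<le> (real n + 2)"
      by (simp_all add: frac_le)
    then show "A m \<subseteq> A n" unfolding A_def by (simp only: atLeastatMost_subset_iff) blast
  qed
  have incB: "incseq B" unfolding BA using incA by (auto simp: incseq_def)
  have [measurable]: "A n \<in> sets borel" "B n \<in> sets borel" for n by (auto simp: A_def B_def)
  have "(\<integral>\<^sup>+s. ?f s * indicator (\<Union>n. B n) s \<partial>lborel) = (SUP n. \<integral>\<^sup>+s. ?f s * indicator (B n) s \<partial>lborel)"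
    by (rule nn_integral_indicator_UN_incseq) (use incB in auto)
  also have "\<dots> = (SUP n. \<integral>\<^sup>+r. h (c / r) * ennreal (1 / \<bar>r\<bar>) * indicator (A n) r \<partial>lborel)"
    by (simp only: fin)
  also have "\<dots> = (\<integral>\<^sup>+r. h (c / r) * ennreal (1 / \<bar>r\<bar>) * indicator (\<Union>n. A n) r \<partial>lborel)"
    by (rule nn_integral_indicator_UN_incseq[symmetric]) (use incA in auto)
  finally show ?thesis by (simp add: UA UB)
qed

lemma nn_integral_inversion:
  fixes h :: "real \<Rightarrow> ennreal" and c :: real
  assumes [measurable]: "h \<in> borel_measurable borel" and c: "c \<noteq> 0"
  shows "(\<integral>\<^sup>+s. h s * ennreal (1 / \<bar>s\<bar>) \<partial>lborel) = (\<integral>\<^sup>+r. h (c / r) * ennreal (1 / \<bar>r\<bar>) \<partial>lborel)"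
proof -
  define P where "P f = (\<integral>\<^sup>+s. f s * ennreal (1 / \<bar>s\<bar>) * indicator {0<..} s \<partial>lborel)" for f :: "real \<Rightarrow> ennreal"
  \<comment> \<open>The origin drops out pointwise, since
    \<open>1 / \<bar>0\<bar> = 0\<close>.\<close>
  have split: "(\<integral>\<^sup>+s. f s * ennreal (1 / \<bar>s\<bar>) \<partial>lborel) = P f + P (\<lambda>s. f (- s))"
    if [measurable]: "f \<in> borel_measurable borel" for f
  proof -
    have "(\<integral>\<^sup>+s. f s * ennreal (1 / \<bar>s\<bar>) \<partial>lborel)
      = (\<integral>\<^sup>+s. f s * ennreal (1 / \<bar>s\<bar>) * indicator {0<..} s + f s * ennreal (1 / \<bar>s\<bar>) * indicator {0<..} (- s) \<partial>lborel)"
      by (intro nn_integral_cong) (auto simp: indicator_def)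
    also have "\<dots> = P f + (\<integral>\<^sup>+s. f s * ennreal (1 / \<bar>s\<bar>) * indicator {0<..} (- s) \<partial>lborel)"
      unfolding P_def by (rule nn_integral_add) auto
    also have "(\<integral>\<^sup>+s. f s * ennreal (1 / \<bar>s\<bar>) * indicator {0<..} (- s) \<partial>lborel) = P (\<lambda>s. f (- s))"
      unfolding P_def
      using nn_integral_real_affine[of "\<lambda>s. f s * ennreal (1 / \<bar>s\<bar>) * indicator {0<..} (- s)" "-1" 0] by simp
    finally show ?thesis .
  qed
  have inv: "P f = P (\<lambda>r. f (d / r))" if [measurable]: "f \<in> borel_measurable borel" and "d > 0" for f d
    unfolding P_def using that(2) by (intro nn_integral_inversion_half_line) auto
  show ?thesis
  proof (cases "c > 0")
    case True
    have "P h = P (\<lambda>r. h (c / r))" by (rule inv) (use True in auto)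
    moreover have "P (\<lambda>s. h (- s)) = P (\<lambda>r. h (- (c / r)))"
      by (rule inv[of "\<lambda>s. h (- s)"]) (use True in auto)
    ultimately show ?thesis by (subst (1 2) split) auto
  next
    case False
    then have c': "- c > 0" using c by simp
    have "P h = P (\<lambda>r. h (- c / r))" by (rule inv) (use c' in auto)
    moreover have "P (\<lambda>s. h (- s)) = P (\<lambda>r. h (- (- c / r)))"
      by (rule inv[of "\<lambda>s. h (- s)"]) (use c' in auto)
    ultimately show ?thesis by (subst (1 2) split) (auto simp: add.commute)
  qed
qed

text \<open>Fubini: with the other coordinates fixed, the form vanishes for a single value of
  \<open>t j\<close>.\<close>

lemma AE_PiM_linear_form_nonzero:
  fixes d :: "'i \<Rightarrow> real"
  assumes I: "finite I" "j \<in> I" and d: "d j \<noteq> 0"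
  shows "AE t in PiM I (\<lambda>_. lborel). (\<Sum>i\<in>I. d i * t i) \<noteq> 0"
proof -
  define J where "J = I - {j}"
  have J: "I = insert j J" "finite J" "j \<notin> J" using I by (auto simp: J_def)
  let ?ind = "\<lambda>t::'i \<Rightarrow> real. indicator {0::real} (\<Sum>i\<in>I. d i * t i) :: ennreal"
  have "(\<integral>\<^sup>+t. ?ind t \<partial>PiM I (\<lambda>_. lborel)) = (\<integral>\<^sup>+t. \<integral>\<^sup>+y. ?ind (t(j := y)) \<partial>lborel \<partial>PiM J (\<lambda>_. lborel))"
    unfolding J(1) by (rule lborel_product.product_nn_integral_insert[OF J(2,3)]) measurable
  also have "\<dots> = (\<integral>\<^sup>+t. 0 \<partial>PiM J (\<lambda>_. lborel :: real measure))"
  proof (intro nn_integral_cong)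
    fix t :: "'i \<Rightarrow> real"
    define q where "q = (\<Sum>i\<in>J. d i * t i)"
    have s: "(\<Sum>i\<in>I. d i * (t(j := y)) i) = q + d j * y" for y
      unfolding J(1) q_def using J by (auto simp: add.commute intro!: sum.cong arg_cong2[where f = "(+)"])
    have "AE y in lborel. y \<noteq> - q / d j" by (rule AE_lborel_singleton)
    then have "AE y in lborel. ?ind (t(j := y)) = 0"
    proof eventually_elim
      case (elim y)
      then have "q + d j * y \<noteq> 0" using d by (simp add: field_simps add_eq_0_iff)
      then show ?case unfolding s by simp
    qed
    then show "(\<integral>\<^sup>+y. ?ind (t(j := y)) \<partial>lborel) = 0"
      by (subst nn_integral_0_iff_AE) (auto simp: s)
  qed
  finally have "(\<integral>\<^sup>+t. ?ind t \<partial>PiM I (\<lambda>_. lborel)) = 0" by simp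
  then have "AE t in PiM I (\<lambda>_. lborel). ?ind t = 0"
    by (subst (asm) nn_integral_0_iff_AE) auto
  then show ?thesis by eventually_elim (auto simp: indicator_def)
qed

section \<open>Lebesgue measure on the span of a family\<close>

text \<open>For an independent family this is the integral over its span divided by the square root
  of the Gram determinant. Leaving that factor in place is deliberate: it cancels in every
  comparison.\<close>

definition flat_integral :: "('a::euclidean_space \<Rightarrow> ennreal) \<Rightarrow> 'i set \<Rightarrow> ('i \<Rightarrow> 'a) \<Rightarrow> ennreal" where
  "flat_integral F I v = (\<integral>\<^sup>+t. F (\<Sum>i\<in>I. t i *\<^sub>R v i) \<partial>PiM I (\<lambda>_. lborel))"

text \<open>Coefficients are attached to indices and not to vectors, so a repeated vector makes the
  family dependent.\<close>

definition indep_family :: "'i set \<Rightarrow> ('i \<Rightarrow> 'a::real_vector) \<Rightarrow> bool" where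
  "indep_family I v \<longleftrightarrow> (\<forall>c. (\<Sum>i\<in>I. c i *\<^sub>R v i) = 0 \<longrightarrow> (\<forall>i\<in>I. c i = 0))"

lemma sigma_finite_PiM_lborel:
  "finite I \<Longrightarrow> sigma_finite_measure (PiM I (\<lambda>_. lborel :: real measure))"
  by (rule lborel_product.sigma_finite)

lemma nn_integral_swap:
  assumes "sigma_finite_measure M" "sigma_finite_measure N"
    and "(\<lambda>(x, y). f x y) \<in> borel_measurable (M \<Otimes>\<^sub>M N)"
  shows "(\<integral>\<^sup>+x. \<integral>\<^sup>+y. f x y \<partial>N \<partial>M) = (\<integral>\<^sup>+y. \<integral>\<^sup>+x. f x y \<partial>M \<partial>N)"
  using pair_sigma_finite.Fubini'[OF pair_sigma_finite.intro[OF assms(1,2)] assms(3)] by simp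

lemma flat_integral_insert:
  fixes F :: "'a::euclidean_space \<Rightarrow> ennreal"
  assumes [measurable]: "F \<in> borel_measurable borel" and I: "finite I" "i \<notin> I"
  shows "flat_integral F (insert i I) v = (\<integral>\<^sup>+s. flat_integral (\<lambda>x. F (x + s *\<^sub>R v i)) I v \<partial>lborel)"
proof -
  have sum_eq: "(\<Sum>j\<in>insert i I. (t(i := s)) j *\<^sub>R v j) = (\<Sum>j\<in>I. t j *\<^sub>R v j) + s *\<^sub>R v i" for t s
    using I by (auto simp: add.commute intro!: sum.cong arg_cong2[where f = "(+)"])
  have "flat_integral F (insert i I) v
      = (\<integral>\<^sup>+s. \<integral>\<^sup>+t. F (\<Sum>j\<in>insert i I. (t(i := s)) j *\<^sub>R v j) \<partial>PiM I (\<lambda>_. lborel) \<partial>lborel)"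
    unfolding flat_integral_def
    by (rule lborel_product.product_nn_integral_insert_rev[OF I]) measurable
  then show ?thesis by (simp only: flat_integral_def sum_eq)
qed

text \<open>Invariance under shifts by vectors of the span; together with reflection invariance it
  is what the uniqueness argument for Haar measure draws on.\<close>

lemma flat_integral_translate:
  fixes F :: "'a::euclidean_space \<Rightarrow> ennreal"
  assumes "finite I" "F \<in> borel_measurable borel"
  shows "flat_integral (\<lambda>x. F (x + (\<Sum>i\<in>I. c i *\<^sub>R v i))) I v = flat_integral F I v"
  using assms
proof (induction I arbitrary: F rule: finite_induct)
  case empty
  then show ?case by simp
next
  case (insert i I)
  note [measurable] = insert.prems
  have "flat_integral (\<lambda>x. F (x + (\<Sum>j\<in>insert i I. c j *\<^sub>R v j))) (insert i I) v
      = (\<integral>\<^sup>+s. flat_integral (\<lambda>x. F (x + s *\<^sub>R v i + (\<Sum>j\<in>insert i I. c j *\<^sub>R v j))) I v \<partial>lborel)"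
    by (rule flat_integral_insert) (use insert.hyps in measurable)
  also have "\<dots> = (\<integral>\<^sup>+s. flat_integral (\<lambda>x. F (x + (c i + s) *\<^sub>R v i)) I v \<partial>lborel)"
  proof (intro nn_integral_cong)
    fix s
    have "flat_integral (\<lambda>x. F (x + (\<Sum>j\<in>I. c j *\<^sub>R v j) + (c i + s) *\<^sub>R v i)) I v
      = flat_integral (\<lambda>x. F (x + (c i + s) *\<^sub>R v i)) I v"
      by (rule insert.IH) measurable
    then show "flat_integral (\<lambda>x. F (x + s *\<^sub>R v i + (\<Sum>j\<in>insert i I. c j *\<^sub>R v j))) I v
       = flat_integral (\<lambda>x. F (x + (c i + s) *\<^sub>R v i)) I v"
      using insert.hyps by (simp add: algebra_simps)
  qed
  also have "\<dots> = (\<integral>\<^sup>+s. flat_integral (\<lambda>x. F (x + s *\<^sub>R v i)) I v \<partial>lborel)"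
  proof -
    interpret sigma_finite_measure "PiM I (\<lambda>_. lborel :: real measure)"
      by (rule sigma_finite_PiM_lborel) fact
    have "(\<lambda>s. flat_integral (\<lambda>x. F (x + s *\<^sub>R v i)) I v) \<in> borel_measurable borel"
      unfolding flat_integral_def by measurable
    from nn_integral_real_affine[OF this, of 1 "c i"] show ?thesis by simp
  qed
  also have "\<dots> = flat_integral F (insert i I) v"
    by (rule flat_integral_insert[symmetric]) (use insert.hyps in measurable)
  finally show ?case .
qed

lemma flat_integral_reflect:
  fixes F :: "'a::euclidean_space \<Rightarrow> ennreal"
  assumes "finite I" "F \<in> borel_measurable borel"
  shows "flat_integral (\<lambda>x. F (- x)) I v = flat_integral F I v"
  using assms
proof (induction I arbitrary: F rule: finite_induct)
  case empty
  then show ?case by (simp add: flat_integral_def)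
next
  case (insert i I)
  note [measurable] = insert.prems
  have "flat_integral (\<lambda>x. F (- x)) (insert i I) v = (\<integral>\<^sup>+s. flat_integral (\<lambda>x. F (- (x + s *\<^sub>R v i))) I v \<partial>lborel)"
    by (rule flat_integral_insert) (use insert.hyps in measurable)
  also have "\<dots> = (\<integral>\<^sup>+s. flat_integral (\<lambda>x. F (x + (- s) *\<^sub>R v i)) I v \<partial>lborel)"
    using insert.IH[of "\<lambda>x. F (x + (- s) *\<^sub>R v i)" for s] by simp
  also have "\<dots> = (\<integral>\<^sup>+s. flat_integral (\<lambda>x. F (x + s *\<^sub>R v i)) I v \<partial>lborel)"
  proof -
    interpret sigma_finite_measure "PiM I (\<lambda>_. lborel :: real measure)"
      by (rule sigma_finite_PiM_lborel) fact
    have "(\<lambda>s. flat_integral (\<lambda>x. F (x + s *\<^sub>R v i)) I v) \<in> borel_measurable borel"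
      unfolding flat_integral_def by measurable
    from nn_integral_real_affine[OF this, of "-1" 0] show ?thesis by simp
  qed
  also have "\<dots> = flat_integral F (insert i I) v"
    by (rule flat_integral_insert[symmetric]) (use insert.hyps in measurable)
  finally show ?case .
qed

text \<open>Two families with the same span induce proportional measures: the Fubini argument for
  the uniqueness of Haar measure, which avoids determinants.\<close>
lemma flat_integral_proportional:
  fixes F G :: "'a::euclidean_space \<Rightarrow> ennreal" and v :: "'i \<Rightarrow> 'a" and w :: "'j \<Rightarrow> 'a"
  assumes I: "finite I" and J: "finite J"
    and [measurable]: "F \<in> borel_measurable borel" "G \<in> borel_measurable borel"
    and vw: "\<And>t. \<exists>c. (\<Sum>i\<in>I. t i *\<^sub>R v i) = (\<Sum>j\<in>J. c j *\<^sub>R w j)"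
    and wv: "\<And>t. \<exists>c. (\<Sum>j\<in>J. t j *\<^sub>R w j) = (\<Sum>i\<in>I. c i *\<^sub>R v i)"
  shows "flat_integral F I v * flat_integral G J w = flat_integral G I v * flat_integral F J w"
proof -
  let ?MI = "PiM I (\<lambda>_. lborel :: real measure)" and ?MJ = "PiM J (\<lambda>_. lborel :: real measure)"
  define x y where "x s = (\<Sum>i\<in>I. s i *\<^sub>R v i)" and "y t = (\<Sum>j\<in>J. t j *\<^sub>R w j)" for s t
  have [measurable]: "x \<in> borel_measurable ?MI" "y \<in> borel_measurable ?MJ"
    unfolding x_def[abs_def] y_def[abs_def] by measurable
  note sf = sigma_finite_PiM_lborel[OF I] sigma_finite_PiM_lborel[OF J]
  have shift: "flat_integral (\<lambda>z. H (z + x s)) J w = flat_integral H J w"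
    if [measurable]: "H \<in> borel_measurable borel" for H s
  proof -
    obtain c where "x s = (\<Sum>j\<in>J. c j *\<^sub>R w j)" using vw by (auto simp: x_def)
    then show ?thesis using flat_integral_translate[OF J that] by simp
  qed
  have shift': "flat_integral (\<lambda>z. H (z - y t)) I v = flat_integral H I v"
    if [measurable]: "H \<in> borel_measurable borel" for H t
  proof -
    obtain c where "y t = (\<Sum>i\<in>I. c i *\<^sub>R v i)" using wv by (auto simp: y_def)
    then have "- y t = (\<Sum>i\<in>I. (- c i) *\<^sub>R v i)" by (simp add: sum_negf)
    then show ?thesis
      unfolding diff_conv_add_uminus by (metis flat_integral_translate[OF I that])
  qed
  have "flat_integral F I v * flat_integral G J w = (\<integral>\<^sup>+s. F (x s) * flat_integral G J w \<partial>?MI)"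
    by (simp add: flat_integral_def x_def nn_integral_multc)
  \<comment> \<open>\<open>G\<close> may be shifted by \<open>x s\<close>, which lies in the common
    span. After the swap, a shift by \<open>- y t\<close> gives
    \<open>F (x s - y t) * G (x s)\<close>; integrating over \<open>t\<close> first, shift and
    reflection remove \<open>x s\<close> from \<open>F\<close>, and the product separates with the
    roles exchanged.\<close>
  also have "\<dots> = (\<integral>\<^sup>+s. \<integral>\<^sup>+t. F (x s) * G (y t + x s) \<partial>?MJ \<partial>?MI)"
  proof (intro nn_integral_cong)
    fix s
    have "F (x s) * flat_integral G J w = F (x s) * flat_integral (\<lambda>z. G (z + x s)) J w"
      by (simp add: shift)
    also have "\<dots> = (\<integral>\<^sup>+t. F (x s) * G (y t + x s) \<partial>?MJ)"
      by (simp add: flat_integral_def nn_integral_cmult flip: y_def)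
    finally show "F (x s) * flat_integral G J w = (\<integral>\<^sup>+t. F (x s) * G (y t + x s) \<partial>?MJ)" .
  qed
  also have "\<dots> = (\<integral>\<^sup>+t. \<integral>\<^sup>+s. F (x s) * G (y t + x s) \<partial>?MI \<partial>?MJ)"
    by (rule nn_integral_swap[OF sf]) measurable
  also have "\<dots> = (\<integral>\<^sup>+t. flat_integral (\<lambda>z. F z * G (y t + z)) I v \<partial>?MJ)"
    by (simp add: flat_integral_def x_def)
  also have "\<dots> = (\<integral>\<^sup>+t. flat_integral (\<lambda>z. F (z - y t) * G z) I v \<partial>?MJ)"
  proof (intro nn_integral_cong)
    fix t
    show "flat_integral (\<lambda>z. F z * G (y t + z)) I v = flat_integral (\<lambda>z. F (z - y t) * G z) I v"
      using shift'[of "\<lambda>z. F z * G (y t + z)" t] by simp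
  qed
  also have "\<dots> = (\<integral>\<^sup>+t. \<integral>\<^sup>+s. F (x s - y t) * G (x s) \<partial>?MI \<partial>?MJ)"
    by (simp add: flat_integral_def x_def)
  also have "\<dots> = (\<integral>\<^sup>+s. \<integral>\<^sup>+t. F (x s - y t) * G (x s) \<partial>?MJ \<partial>?MI)"
    by (rule nn_integral_swap[OF sf(2,1)]) measurable
  also have "\<dots> = (\<integral>\<^sup>+s. flat_integral F J w * G (x s) \<partial>?MI)"
  proof (intro nn_integral_cong)
    fix s
    have "flat_integral F J w = flat_integral (\<lambda>z. F (- z + x s)) J w"
      using shift[of F s] flat_integral_reflect[OF J, of "\<lambda>z. F (z + x s)" w] by simp
    also have "\<dots> = (\<integral>\<^sup>+t. F (x s - y t) \<partial>?MJ)" by (simp add: flat_integral_def y_def)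
    finally show "(\<integral>\<^sup>+t. F (x s - y t) * G (x s) \<partial>?MJ) = flat_integral F J w * G (x s)"
      by (simp add: nn_integral_multc)
  qed
  also have "\<dots> = flat_integral G I v * flat_integral F J w"
    by (subst nn_integral_cmult) (auto simp: flat_integral_def x_def mult.commute)
  finally show ?thesis .
qed

section \<open>Disintegration over random hyperplanes\<close>

text \<open>For a random covector \<open>\<xi>\<close> with independent Cauchy entries of scales \<open>c\<close>, the variable
  \<open>\<xi> \<bullet> x\<close> is Cauchy of scale \<open>N x = \<Sum>j. c j * \<bar>x \<bullet> j\<bar>\<close>, so its density at \<open>0\<close> is \<open>1 / (\<pi> N x)\<close>.
  Hence \<open>N\<^sup>-\<^sup>1\<close> times Lebesgue measure is a mixture of measures on the random hyperplanes \<open>\<xi> \<bullet> x = 0\<close>.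
  Here \<open>\<zeta>\<close> collects the entries of \<open>\<xi>\<close> off the coordinate \<open>i\<close>, and \<open>r\<close> is the value of \<open>\<xi>\<close> on the
  direction \<open>a\<close> along which the hyperplane is written as a graph.\<close>
lemma flat_integral_disintegration:
  fixes v :: "'i \<Rightarrow> 'a::euclidean_space" and c :: "'a \<Rightarrow> real"
  assumes I: "finite I" "p \<in> I" "q \<in> I" "q \<noteq> p" and v: "indep_family I v"
    and c: "\<And>j. j \<in> Basis \<Longrightarrow> c j > 0"
  obtains i :: 'a and \<rho> :: "('a \<Rightarrow> real) \<Rightarrow> real \<Rightarrow> ennreal" and w :: "('a \<Rightarrow> real) \<Rightarrow> real \<Rightarrow> 'i \<Rightarrow> 'a"
  where "\<And>\<zeta> r. indep_family (I - {p}) (w \<zeta> r)"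
    and "\<And>\<Phi>. \<Phi> \<in> borel_measurable borel \<Longrightarrow>
      (\<lambda>(\<zeta>, r). \<rho> \<zeta> r * flat_integral \<Phi> (I - {p}) (w \<zeta> r)) \<in> borel_measurable (PiM (Basis - {i}) (\<lambda>_. lborel) \<Otimes>\<^sub>M lborel)"
    and "\<And>\<Phi>. \<Phi> \<in> borel_measurable borel \<Longrightarrow>
      flat_integral (\<lambda>x. \<Phi> x * ennreal (1 / (\<Sum>j\<in>Basis. c j * \<bar>x \<bullet> j\<bar>))) I v
        = (\<integral>\<^sup>+\<zeta>. \<integral>\<^sup>+r. \<rho> \<zeta> r * flat_integral \<Phi> (I - {p}) (w \<zeta> r) \<partial>lborel \<partial>PiM (Basis - {i}) (\<lambda>_. lborel))"
proof -
  let ?I' = "I - {p}"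
  have fin: "finite ?I'" "p \<notin> ?I'" "I = insert p ?I'" using I by auto
  have "v p \<noteq> 0"
  proof
    assume "v p = 0"
    then have "(\<Sum>l\<in>I. (if l = p then 1 else 0) *\<^sub>R v l) = 0"
      by (intro sum.neutral) auto
    then show False using v[unfolded indep_family_def, rule_format, of "\<lambda>l. if l = p then 1 else 0" p] I by simp
  qed
  then obtain i where i: "i \<in> Basis" "v p \<bullet> i \<noteq> 0" using euclidean_all_zero_iff by blast
  let ?B = "Basis - {i}"
  let ?MB = "PiM ?B (\<lambda>_. lborel :: real measure)" and ?MI = "PiM ?I' (\<lambda>_. lborel :: real measure)"
  \<comment> \<open>\<open>a\<close> is \<open>v p\<close> rescaled to have \<open>i\<close>-th
    coordinate 1, and each \<open>u l\<close> is \<open>v l\<close> sheared along \<open>a\<close>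
    to have \<open>i\<close>-th coordinate 0. So in
    \<open>(\<Sum>l\<in>I - {p}. t l *\<^sub>R u l) + s *\<^sub>R a\<close> the parameter
    \<open>s\<close> is the \<open>i\<close>-th coordinate. The shear costs nothing; the rescaling
    costs a factor \<open>\<bar>K\<bar>\<close>.\<close>
  define K where "K = 1 / (v p \<bullet> i)"
  have K: "K \<noteq> 0" using i by (simp add: K_def)
  define a where "a = K *\<^sub>R v p"
  have ai: "a \<bullet> i = 1" using i by (simp add: a_def K_def)
  define u where "u l = v l - (v l \<bullet> i) *\<^sub>R a" for l
  have ui: "u l \<bullet> i = 0" for l using ai by (simp add: u_def inner_diff_left)
  have uv: "(\<Sum>l\<in>?I'. t l *\<^sub>R u l) + s *\<^sub>R a
      = (\<Sum>l\<in>?I'. t l *\<^sub>R v l) + ((s - (\<Sum>l\<in>?I'. t l * (v l \<bullet> i))) * K) *\<^sub>R v p" for t s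
    by (simp add: u_def a_def algebra_simps sum_subtractf scaleR_sum_left sum_distrib_right sum_distrib_left)
  have indep: "\<forall>l\<in>?I'. t l = 0" if "(\<Sum>l\<in>?I'. t l *\<^sub>R u l) + s *\<^sub>R a = 0" for t s
  proof -
    define m where "m = (s - (\<Sum>l\<in>?I'. t l * (v l \<bullet> i))) * K"
    have "(\<Sum>l\<in>I. (t(p := m)) l *\<^sub>R v l) = m *\<^sub>R v p + (\<Sum>l\<in>?I'. (t(p := m)) l *\<^sub>R v l)"
      using I by (subst sum.remove[of I p]) auto
    also have "(\<Sum>l\<in>?I'. (t(p := m)) l *\<^sub>R v l) = (\<Sum>l\<in>?I'. t l *\<^sub>R v l)" by (intro sum.cong) auto
    finally have "(\<Sum>l\<in>I. (t(p := m)) l *\<^sub>R v l) = 0" using that uv[of t s] by (simp add: m_def add.commute)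
    then have "\<forall>l\<in>I. (t(p := m)) l = 0" using v unfolding indep_family_def by blast
    then show ?thesis by (metis DiffE fun_upd_other singletonI)
  qed
  \<comment> \<open>\<open>y \<zeta> l\<close> and \<open>X \<zeta>\<close> are the contributions of
    the coordinates other than \<open>i\<close> to the values of the covector on \<open>u l\<close>
    and \<open>a\<close>. With \<open>i\<close>-th entry \<open>r - X \<zeta>\<close> its value on
    \<open>a\<close> is \<open>r\<close>, and for \<open>r\<close> nonzero the vectors
    \<open>w \<zeta> r l\<close> span its kernel within the span of \<open>v\<close>.\<close>
  define y where "y \<zeta> l = (\<Sum>j\<in>?B. c j * \<zeta> j * (u l \<bullet> j))" for \<zeta> l
  define X where "X \<zeta> = (\<Sum>j\<in>?B. c j * \<zeta> j * (a \<bullet> j))" for \<zeta>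
  define w where "w \<zeta> r l = u l - (y \<zeta> l / r) *\<^sub>R a" for \<zeta> r l
  define P where "P \<zeta> = (\<Prod>j\<in>?B. ennreal (cauchy_density 1 (\<zeta> j)))" for \<zeta> :: "'a \<Rightarrow> real"
  \<comment> \<open>\<open>pi\<close> turns a Cauchy density at 0 into \<open>1 / N\<close>,
    \<open>P\<close> is the joint density of \<open>\<zeta>\<close>, the next factor is the even
    density of the entry \<open>r - X \<zeta>\<close>, and \<open>1 / \<bar>r\<bar>\<close> results
    from inverting \<open>s\<close>. At \<open>r = 0\<close> the weight is 0, so the value of
    \<open>w\<close> there is irrelevant.\<close>
  define \<rho> where "\<rho> \<zeta> r = ennreal (pi * \<bar>K\<bar>) * P \<zeta> * ennreal (cauchy_density (c i) (X \<zeta> - r)) * ennreal (1 / \<bar>r\<bar>)" for \<zeta> r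
  define b where "b t = (\<Sum>l\<in>?I'. t l *\<^sub>R u l)" for t
  define Y where "Y \<zeta> t = (\<Sum>l\<in>?I'. t l * y \<zeta> l)" for \<zeta> t
  let ?N = "\<lambda>x::'a. \<Sum>j\<in>Basis. c j * \<bar>x \<bullet> j\<bar>"
  have [measurable]: "X \<in> borel_measurable ?MB" "(\<lambda>\<zeta>. y \<zeta> l) \<in> borel_measurable ?MB"
      "P \<in> borel_measurable ?MB" "b \<in> borel_measurable ?MI" for l
    unfolding X_def[abs_def] y_def[abs_def] P_def[abs_def] b_def[abs_def] by measurable
  have Ym [measurable (raw)]: "(\<lambda>z. Y (f z) (g z)) \<in> borel_measurable M"
    if "f \<in> measurable M ?MB" "g \<in> measurable M ?MI" for f g and M :: "'z measure"
  proof -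
    have "(\<lambda>z. g z l) \<in> borel_measurable M" if "l \<in> ?I'" for l
      by (rule measurable_compose[OF \<open>g \<in> measurable M ?MI\<close>]) (use that in measurable)
    moreover have "(\<lambda>z. y (f z) l) \<in> borel_measurable M" for l
      by (rule measurable_compose[OF \<open>f \<in> measurable M ?MB\<close>]) measurable
    ultimately show ?thesis unfolding Y_def by (intro borel_measurable_sum borel_measurable_times)
  qed
  have [measurable]: "(\<lambda>\<zeta>. Y \<zeta> t) \<in> borel_measurable ?MB" "Y \<zeta> \<in> borel_measurable ?MI" for t \<zeta>
    unfolding Y_def[abs_def] by measurable
  have bi: "b t \<bullet> i = 0" for t by (simp add: b_def inner_sum_left ui)
  have w_sum: "(\<Sum>l\<in>?I'. t l *\<^sub>R w \<zeta> r l) = b t + (- Y \<zeta> t / r) *\<^sub>R a" for t \<zeta> r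
    by (simp add: w_def b_def Y_def scaleR_diff_right sum_subtractf scaleR_sum_left sum_divide_distrib)
  have lin: "(\<Sum>j\<in>?B. c j * ((b t + s *\<^sub>R a) \<bullet> j) * \<zeta> j) = Y \<zeta> t + s * X \<zeta>" for \<zeta> t s
  proof -
    have "Y \<zeta> t = (\<Sum>j\<in>?B. \<Sum>l\<in>?I'. t l * (c j * \<zeta> j * (u l \<bullet> j)))"
      unfolding Y_def y_def sum_distrib_left by (rule sum.swap)
    also have "\<dots> = (\<Sum>j\<in>?B. c j * \<zeta> j * (b t \<bullet> j))"
      by (simp add: b_def inner_sum_left sum_distrib_left mult_ac)
    finally show ?thesis
      by (simp add: X_def sum_distrib_left inner_add_left sum.distrib[symmetric] algebra_simps)
  qed
  note sfB = sigma_finite_PiM_lborel[of ?B, simplified] and sfI = sigma_finite_PiM_lborel[OF fin(1)]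
  interpret sI: sigma_finite_measure ?MI by (rule sfI)
  interpret sB: sigma_finite_measure ?MB by (rule sfB)
  \<comment> \<open>The density of the random form at 0: coordinate \<open>i\<close> supplies the
    positive scale \<open>c i * \<bar>s\<bar>\<close>, the others are mixed in, and homogeneity then
    takes \<open>\<bar>s\<bar>\<close> out of the density.\<close>
  have N_formula: "ennreal (1 / ?N (b t + s *\<^sub>R a))
     = (\<integral>\<^sup>+\<zeta>. ennreal pi * (P \<zeta> * (ennreal (cauchy_density (c i) (Y \<zeta> t / s + X \<zeta>)) * ennreal (1 / \<bar>s\<bar>))) \<partial>?MB)"
    if s: "s \<noteq> 0" for s t
  proof -
    let ?x = "b t + s *\<^sub>R a"
    have xi: "?x \<bullet> i = s" by (simp add: inner_add_left bi ai)
    have cs: "c i * \<bar>s\<bar> > 0" using c i s by simp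
    have N: "?N ?x = c i * \<bar>s\<bar> + (\<Sum>j\<in>?B. \<bar>c j * (?x \<bullet> j)\<bar>)"
    proof -
      have "?N ?x = c i * \<bar>?x \<bullet> i\<bar> + (\<Sum>j\<in>?B. c j * \<bar>?x \<bullet> j\<bar>)"
        using i by (intro sum.remove) auto
      also have "(\<Sum>j\<in>?B. c j * \<bar>?x \<bullet> j\<bar>) = (\<Sum>j\<in>?B. \<bar>c j * (?x \<bullet> j)\<bar>)"
        using c by (intro sum.cong) (auto simp: abs_mult abs_of_pos)
      finally show ?thesis by (simp only: xi)
    qed
    have "?N ?x > 0" unfolding N using cs by (intro add_pos_nonneg sum_nonneg) auto
    then have "1 / ?N ?x = pi * cauchy_density (?N ?x) 0"
      by (simp add: cauchy_density_def power2_eq_square)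
    then have "ennreal (1 / ?N ?x) = ennreal pi * ennreal (cauchy_density (?N ?x) 0)"
      by (simp add: ennreal_mult')
    also have "ennreal (cauchy_density (?N ?x) 0)
      = (\<integral>\<^sup>+\<zeta>. P \<zeta> * ennreal (cauchy_density (c i * \<bar>s\<bar>) (0 + (\<Sum>j\<in>?B. (c j * (?x \<bullet> j)) * \<zeta> j))) \<partial>?MB)"
      unfolding N P_def by (rule cauchy_mixture[symmetric]) (use cs in auto)
    also have "\<dots> = (\<integral>\<^sup>+\<zeta>. P \<zeta> * (ennreal (cauchy_density (c i) (Y \<zeta> t / s + X \<zeta>)) * ennreal (1 / \<bar>s\<bar>)) \<partial>?MB)"
    proof (intro nn_integral_cong)
      fix \<zeta>
      have "cauchy_density (c i * \<bar>s\<bar>) (Y \<zeta> t + s * X \<zeta>) = cauchy_density (c i) (Y \<zeta> t / s + X \<zeta>) * (1 / \<bar>s\<bar>)"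
      proof -
        define z where "z = Y \<zeta> t / s + X \<zeta>"
        have "Y \<zeta> t + s * X \<zeta> = s * z" using s by (simp add: z_def distrib_left)
        moreover have "(c i * \<bar>s\<bar>)\<^sup>2 + (s * z)\<^sup>2 = \<bar>s\<bar> * \<bar>s\<bar> * ((c i)\<^sup>2 + z\<^sup>2)"
          by (simp add: power_mult_distrib power2_eq_square algebra_simps flip: abs_mult)
        moreover have "(c i)\<^sup>2 + z\<^sup>2 \<noteq> 0" using c[OF i(1)] by (simp add: sum_power2_eq_zero_iff)
        ultimately show ?thesis unfolding z_def[symmetric] using s
          by (simp add: cauchy_density_def abs_if divide_simps)
      qed
      then show "P \<zeta> * ennreal (cauchy_density (c i * \<bar>s\<bar>) (0 + (\<Sum>j\<in>?B. (c j * (?x \<bullet> j)) * \<zeta> j)))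
        = P \<zeta> * (ennreal (cauchy_density (c i) (Y \<zeta> t / s + X \<zeta>)) * ennreal (1 / \<bar>s\<bar>))"
        unfolding lin using c[OF i(1)] by (simp add: ennreal_mult[symmetric] cauchy_density_nonneg)
    qed
    finally show ?thesis by (simp add: nn_integral_cmult)
  qed
  \<comment> \<open>The coming inversion divides by \<open>Y \<zeta> t\<close>. The second index
    \<open>q\<close> enters here: without it \<open>Y\<close> would be an empty sum.\<close>
  have nonzero: "AE \<zeta> in ?MB. AE t in ?MI. Y \<zeta> t \<noteq> 0"
  proof -
    have q: "q \<in> ?I'" using I by simp
    have "u q \<noteq> 0"
    proof
      assume "u q = 0"
      then have "(\<Sum>l\<in>?I'. (if l = q then 1 else 0) *\<^sub>R u l) + 0 *\<^sub>R a = 0"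
        by (simp add: sum.neutral)
      from bspec[OF indep[OF this] q] show False by simp
    qed
    then obtain j where j: "j \<in> Basis" "u q \<bullet> j \<noteq> 0" using euclidean_all_zero_iff by blast
    then have "j \<in> ?B" using ui by auto
    moreover have "c j * (u q \<bullet> j) \<noteq> 0" using j c[of j] by simp
    ultimately have "AE \<zeta> in ?MB. (\<Sum>j\<in>?B. (c j * (u q \<bullet> j)) * \<zeta> j) \<noteq> 0"
      by (intro AE_PiM_linear_form_nonzero[where j = j]) auto
    then show ?thesis
    proof eventually_elim
      case (elim \<zeta>)
      then have "y \<zeta> q \<noteq> 0" by (simp add: y_def mult_ac)
      then have "AE t in ?MI. (\<Sum>l\<in>?I'. y \<zeta> l * t l) \<noteq> 0"
        by (intro AE_PiM_linear_form_nonzero[OF fin(1) q])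
      then show ?case by (simp add: Y_def mult.commute)
    qed
  qed
  show thesis
  proof
    fix \<zeta> r
    show "indep_family ?I' (w \<zeta> r)"
      unfolding indep_family_def
    proof (intro allI impI)
      fix t assume "(\<Sum>l\<in>?I'. t l *\<^sub>R w \<zeta> r l) = 0"
      then show "\<forall>l\<in>?I'. t l = 0" unfolding w_sum b_def by (rule indep)
    qed
  next
    fix \<Phi> :: "'a \<Rightarrow> ennreal" assume [measurable]: "\<Phi> \<in> borel_measurable borel"
    show "(\<lambda>(\<zeta>, r). \<rho> \<zeta> r * flat_integral \<Phi> ?I' (w \<zeta> r)) \<in> borel_measurable (?MB \<Otimes>\<^sub>M lborel)"
      unfolding flat_integral_def w_sum \<rho>_def by measurable
    let ?\<kappa> = "ennreal (pi * \<bar>K\<bar>)"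
    let ?h = "\<lambda>\<zeta> t s. \<Phi> (b t + s *\<^sub>R a) * ennreal (cauchy_density (c i) (Y \<zeta> t / s + X \<zeta>))"
    have "flat_integral (\<lambda>x. \<Phi> x * ennreal (1 / ?N x)) I v
      = (\<integral>\<^sup>+t. \<integral>\<^sup>+s. \<Phi> (\<Sum>l\<in>I. (t(p := s)) l *\<^sub>R v l) * ennreal (1 / ?N (\<Sum>l\<in>I. (t(p := s)) l *\<^sub>R v l)) \<partial>lborel \<partial>?MI)"
      unfolding flat_integral_def
      by (rule lborel_product.product_nn_integral_insert[OF fin(1,2), folded fin(3)]) measurable
    also have "\<dots> = (\<integral>\<^sup>+t. ennreal \<bar>K\<bar> * (\<integral>\<^sup>+s. \<Phi> (b t + s *\<^sub>R a) * ennreal (1 / ?N (b t + s *\<^sub>R a)) \<partial>lborel) \<partial>?MI)"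
    proof (intro nn_integral_cong)
      fix t :: "'i \<Rightarrow> real"
      define m where "m = (\<Sum>l\<in>?I'. t l * (v l \<bullet> i))"
      have ts: "(\<Sum>l\<in>I. (t(p := s)) l *\<^sub>R v l) = (\<Sum>l\<in>?I'. t l *\<^sub>R v l) + s *\<^sub>R v p" for s
      proof -
        have "(\<Sum>l\<in>I. (t(p := s)) l *\<^sub>R v l) = s *\<^sub>R v p + (\<Sum>l\<in>?I'. (t(p := s)) l *\<^sub>R v l)"
          using I by (subst sum.remove[of I p]) auto
        also have "(\<Sum>l\<in>?I'. (t(p := s)) l *\<^sub>R v l) = (\<Sum>l\<in>?I'. t l *\<^sub>R v l)" by (intro sum.cong) auto
        finally show ?thesis by (simp add: add.commute)
      qed
      have bt: "b t + s *\<^sub>R a = (\<Sum>l\<in>?I'. t l *\<^sub>R v l) + (- m * K + K * s) *\<^sub>R v p" for s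
        using uv[of t s] by (simp add: b_def m_def algebra_simps)
      show "(\<integral>\<^sup>+s. \<Phi> (\<Sum>l\<in>I. (t(p := s)) l *\<^sub>R v l) * ennreal (1 / ?N (\<Sum>l\<in>I. (t(p := s)) l *\<^sub>R v l)) \<partial>lborel)
        = ennreal \<bar>K\<bar> * (\<integral>\<^sup>+s. \<Phi> (b t + s *\<^sub>R a) * ennreal (1 / ?N (b t + s *\<^sub>R a)) \<partial>lborel)"
        unfolding ts bt by (rule nn_integral_real_affine) (use K in auto)
    qed
    also have "\<dots> = (\<integral>\<^sup>+t. \<integral>\<^sup>+\<zeta>. ?\<kappa> * (P \<zeta> * (\<integral>\<^sup>+s. ?h \<zeta> t s * ennreal (1 / \<bar>s\<bar>) \<partial>lborel)) \<partial>?MB \<partial>?MI)"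
    proof (intro nn_integral_cong)
      fix t assume t [measurable]: "t \<in> space ?MI"
      have "(\<integral>\<^sup>+s. \<Phi> (b t + s *\<^sub>R a) * ennreal (1 / ?N (b t + s *\<^sub>R a)) \<partial>lborel)
        = (\<integral>\<^sup>+s. \<integral>\<^sup>+\<zeta>. \<Phi> (b t + s *\<^sub>R a) * (ennreal pi * (P \<zeta> * (ennreal (cauchy_density (c i) (Y \<zeta> t / s + X \<zeta>)) * ennreal (1 / \<bar>s\<bar>)))) \<partial>?MB \<partial>lborel)"
      proof (rule nn_integral_cong_AE)
        have "AE s in lborel. s \<noteq> (0::real)" by (rule AE_lborel_singleton)
        then show "AE s in lborel. \<Phi> (b t + s *\<^sub>R a) * ennreal (1 / ?N (b t + s *\<^sub>R a))
          = (\<integral>\<^sup>+\<zeta>. \<Phi> (b t + s *\<^sub>R a) * (ennreal pi * (P \<zeta> * (ennreal (cauchy_density (c i) (Y \<zeta> t / s + X \<zeta>)) * ennreal (1 / \<bar>s\<bar>)))) \<partial>?MB)"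
        proof eventually_elim
          case (elim s)
          show ?case unfolding N_formula[OF elim] by (rule nn_integral_cmult[symmetric]) measurable
        qed
      qed
      also have "\<dots> = (\<integral>\<^sup>+\<zeta>. \<integral>\<^sup>+s. \<Phi> (b t + s *\<^sub>R a) * (ennreal pi * (P \<zeta> * (ennreal (cauchy_density (c i) (Y \<zeta> t / s + X \<zeta>)) * ennreal (1 / \<bar>s\<bar>)))) \<partial>lborel \<partial>?MB)"
        by (rule nn_integral_swap[OF lborel.sigma_finite_measure_axioms sfB]) measurable
      also have "\<dots> = (\<integral>\<^sup>+\<zeta>. ennreal pi * (P \<zeta> * (\<integral>\<^sup>+s. ?h \<zeta> t s * ennreal (1 / \<bar>s\<bar>) \<partial>lborel)) \<partial>?MB)"
      proof (intro nn_integral_cong)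
        fix \<zeta> assume [measurable]: "\<zeta> \<in> space ?MB"
        have "(\<integral>\<^sup>+s. \<Phi> (b t + s *\<^sub>R a) * (ennreal pi * (P \<zeta> * (ennreal (cauchy_density (c i) (Y \<zeta> t / s + X \<zeta>)) * ennreal (1 / \<bar>s\<bar>)))) \<partial>lborel)
          = (\<integral>\<^sup>+s. (ennreal pi * P \<zeta>) * (?h \<zeta> t s * ennreal (1 / \<bar>s\<bar>)) \<partial>lborel)"
          by (simp add: mult_ac)
        also have "\<dots> = (ennreal pi * P \<zeta>) * (\<integral>\<^sup>+s. ?h \<zeta> t s * ennreal (1 / \<bar>s\<bar>) \<partial>lborel)"
          by (rule nn_integral_cmult) measurable
        finally show "(\<integral>\<^sup>+s. \<Phi> (b t + s *\<^sub>R a) * (ennreal pi * (P \<zeta> * (ennreal (cauchy_density (c i) (Y \<zeta> t / s + X \<zeta>)) * ennreal (1 / \<bar>s\<bar>)))) \<partial>lborel)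
          = ennreal pi * (P \<zeta> * (\<integral>\<^sup>+s. ?h \<zeta> t s * ennreal (1 / \<bar>s\<bar>) \<partial>lborel))" by (simp add: mult.assoc)
      qed
      finally have *: "(\<integral>\<^sup>+s. \<Phi> (b t + s *\<^sub>R a) * ennreal (1 / ?N (b t + s *\<^sub>R a)) \<partial>lborel)
        = (\<integral>\<^sup>+\<zeta>. ennreal pi * (P \<zeta> * (\<integral>\<^sup>+s. ?h \<zeta> t s * ennreal (1 / \<bar>s\<bar>) \<partial>lborel)) \<partial>?MB)" .
      have "ennreal \<bar>K\<bar> * (\<integral>\<^sup>+\<zeta>. ennreal pi * (P \<zeta> * (\<integral>\<^sup>+s. ?h \<zeta> t s * ennreal (1 / \<bar>s\<bar>) \<partial>lborel)) \<partial>?MB)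
        = (\<integral>\<^sup>+\<zeta>. ennreal \<bar>K\<bar> * (ennreal pi * (P \<zeta> * (\<integral>\<^sup>+s. ?h \<zeta> t s * ennreal (1 / \<bar>s\<bar>) \<partial>lborel))) \<partial>?MB)"
        by (rule nn_integral_cmult[symmetric]) measurable
      then show "ennreal \<bar>K\<bar> * (\<integral>\<^sup>+s. \<Phi> (b t + s *\<^sub>R a) * ennreal (1 / ?N (b t + s *\<^sub>R a)) \<partial>lborel)
        = (\<integral>\<^sup>+\<zeta>. ?\<kappa> * (P \<zeta> * (\<integral>\<^sup>+s. ?h \<zeta> t s * ennreal (1 / \<bar>s\<bar>) \<partial>lborel)) \<partial>?MB)"
        unfolding * by (simp add: ennreal_mult mult_ac)
    qed
    also have "\<dots> = (\<integral>\<^sup>+\<zeta>. \<integral>\<^sup>+t. ?\<kappa> * (P \<zeta> * (\<integral>\<^sup>+s. ?h \<zeta> t s * ennreal (1 / \<bar>s\<bar>) \<partial>lborel)) \<partial>?MI \<partial>?MB)"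
      by (rule nn_integral_swap[OF sfI sfB]) measurable
    also have "\<dots> = (\<integral>\<^sup>+\<zeta>. \<integral>\<^sup>+t. \<integral>\<^sup>+r. \<rho> \<zeta> r * \<Phi> (\<Sum>l\<in>?I'. t l *\<^sub>R w \<zeta> r l) \<partial>lborel \<partial>?MI \<partial>?MB)"
    proof (intro nn_integral_cong_AE)
      show "AE \<zeta> in ?MB. (\<integral>\<^sup>+t. ?\<kappa> * (P \<zeta> * (\<integral>\<^sup>+s. ?h \<zeta> t s * ennreal (1 / \<bar>s\<bar>) \<partial>lborel)) \<partial>?MI)
         = (\<integral>\<^sup>+t. \<integral>\<^sup>+r. \<rho> \<zeta> r * \<Phi> (\<Sum>l\<in>?I'. t l *\<^sub>R w \<zeta> r l) \<partial>lborel \<partial>?MI)"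
        using nonzero AE_space
      proof eventually_elim
        case (elim \<zeta>)
        note [measurable] = elim(2)
        show ?case
        proof (rule nn_integral_cong_AE)
          show "AE t in ?MI. ?\<kappa> * (P \<zeta> * (\<integral>\<^sup>+s. ?h \<zeta> t s * ennreal (1 / \<bar>s\<bar>) \<partial>lborel))
            = (\<integral>\<^sup>+r. \<rho> \<zeta> r * \<Phi> (\<Sum>l\<in>?I'. t l *\<^sub>R w \<zeta> r l) \<partial>lborel)"
            using elim(1) AE_space
          proof eventually_elim
            case (elim t)
            note [measurable] = elim(2)
            \<comment> \<open>The kernel equation reads \<open>s = - Y \<zeta> t / r\<close>. Taking
              \<open>r\<close> as the variable turns integration along \<open>a\<close> into
              integration over hyperplanes, and \<open>X \<zeta> + Y \<zeta> t / s\<close> becomes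
              \<open>X \<zeta> - r\<close>, free of \<open>t\<close>.\<close>
            have "(\<integral>\<^sup>+s. ?h \<zeta> t s * ennreal (1 / \<bar>s\<bar>) \<partial>lborel)
              = (\<integral>\<^sup>+r. ?h \<zeta> t (- Y \<zeta> t / r) * ennreal (1 / \<bar>r\<bar>) \<partial>lborel)"
              by (rule nn_integral_inversion) (use elim(1) in auto)
            also have "\<dots> = (\<integral>\<^sup>+r. \<Phi> (\<Sum>l\<in>?I'. t l *\<^sub>R w \<zeta> r l) * ennreal (cauchy_density (c i) (X \<zeta> - r)) * ennreal (1 / \<bar>r\<bar>) \<partial>lborel)"
            proof (intro nn_integral_cong)
              fix r
              have "Y \<zeta> t / (- Y \<zeta> t / r) + X \<zeta> = X \<zeta> - r" using elim(1) by simp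
              then show "?h \<zeta> t (- Y \<zeta> t / r) * ennreal (1 / \<bar>r\<bar>)
                = \<Phi> (\<Sum>l\<in>?I'. t l *\<^sub>R w \<zeta> r l) * ennreal (cauchy_density (c i) (X \<zeta> - r)) * ennreal (1 / \<bar>r\<bar>)"
                by (simp only: w_sum)
            qed
            finally have "?\<kappa> * (P \<zeta> * (\<integral>\<^sup>+s. ?h \<zeta> t s * ennreal (1 / \<bar>s\<bar>) \<partial>lborel))
              = (?\<kappa> * P \<zeta>) * (\<integral>\<^sup>+r. \<Phi> (\<Sum>l\<in>?I'. t l *\<^sub>R w \<zeta> r l) * ennreal (cauchy_density (c i) (X \<zeta> - r)) * ennreal (1 / \<bar>r\<bar>) \<partial>lborel)"
              by (simp only: mult.assoc)
            also have "\<dots> = (\<integral>\<^sup>+r. (?\<kappa> * P \<zeta>) * (\<Phi> (\<Sum>l\<in>?I'. t l *\<^sub>R w \<zeta> r l) * ennreal (cauchy_density (c i) (X \<zeta> - r)) * ennreal (1 / \<bar>r\<bar>)) \<partial>lborel)"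
              unfolding w_sum by (rule nn_integral_cmult[symmetric]) measurable
            finally show ?case by (simp add: \<rho>_def mult_ac)
          qed
        qed
      qed
    qed
    also have "\<dots> = (\<integral>\<^sup>+\<zeta>. \<integral>\<^sup>+r. \<integral>\<^sup>+t. \<rho> \<zeta> r * \<Phi> (\<Sum>l\<in>?I'. t l *\<^sub>R w \<zeta> r l) \<partial>?MI \<partial>lborel \<partial>?MB)"
    proof (intro nn_integral_cong)
      fix \<zeta> assume [measurable]: "\<zeta> \<in> space ?MB"
      show "(\<integral>\<^sup>+t. \<integral>\<^sup>+r. \<rho> \<zeta> r * \<Phi> (\<Sum>l\<in>?I'. t l *\<^sub>R w \<zeta> r l) \<partial>lborel \<partial>?MI)
        = (\<integral>\<^sup>+r. \<integral>\<^sup>+t. \<rho> \<zeta> r * \<Phi> (\<Sum>l\<in>?I'. t l *\<^sub>R w \<zeta> r l) \<partial>?MI \<partial>lborel)"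
        unfolding w_sum \<rho>_def
        by (rule nn_integral_swap[OF sfI lborel.sigma_finite_measure_axioms]) measurable
    qed
    also have "\<dots> = (\<integral>\<^sup>+\<zeta>. \<integral>\<^sup>+r. \<rho> \<zeta> r * flat_integral \<Phi> ?I' (w \<zeta> r) \<partial>lborel \<partial>?MB)"
    proof (intro nn_integral_cong)
      fix \<zeta> r
      show "(\<integral>\<^sup>+t. \<rho> \<zeta> r * \<Phi> (\<Sum>l\<in>?I'. t l *\<^sub>R w \<zeta> r l) \<partial>?MI) = \<rho> \<zeta> r * flat_integral \<Phi> ?I' (w \<zeta> r)"
        unfolding flat_integral_def by (rule nn_integral_cmult) measurable
    qed
    finally show "flat_integral (\<lambda>x. \<Phi> x * ennreal (1 / ?N x)) I v
      = (\<integral>\<^sup>+\<zeta>. \<integral>\<^sup>+r. \<rho> \<zeta> r * flat_integral \<Phi> ?I' (w \<zeta> r) \<partial>lborel \<partial>?MB)" .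
  qed
qed

section \<open>Sections and the slicing inequality\<close>

text \<open>Both sides are mixtures of hyperplane integrals with the same weights, which do not
  depend on the integrand, so a bound on each hyperplane survives the mixing.\<close>

lemma flat_integral_hyperplane_step:
  fixes F G :: "'a::euclidean_space \<Rightarrow> ennreal" and v :: "'i \<Rightarrow> 'a" and c :: "'a \<Rightarrow> real"
  assumes I: "finite I" "card I \<ge> 2" and v: "indep_family I v"
    and c: "\<And>j. j \<in> Basis \<Longrightarrow> c j > 0"
    and F: "F \<in> borel_measurable borel" and G: "G \<in> borel_measurable borel"
    and le: "\<And>J w. finite J \<Longrightarrow> card J = card I - 1 \<Longrightarrow> indep_family J w \<Longrightarrow>
      flat_integral F (J :: 'i set) w \<le> C * flat_integral G J w"
  shows "flat_integral (\<lambda>x. F x * ennreal (1 / (\<Sum>j\<in>Basis. c j * \<bar>x \<bullet> j\<bar>))) I v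
    \<le> C * flat_integral (\<lambda>x. G x * ennreal (1 / (\<Sum>j\<in>Basis. c j * \<bar>x \<bullet> j\<bar>))) I v"
proof -
  obtain p q where pq: "p \<in> I" "q \<in> I" "q \<noteq> p"
    using I by (metis One_nat_def card_le_Suc0_iff_eq not_less_eq_eq numeral_2_eq_2)
  note [measurable] = F G
  show ?thesis
  proof (rule flat_integral_disintegration[OF I(1) pq v, where c = c])
    show "c j > 0" if "j \<in> Basis" for j by (rule c[OF that])
  next
    fix i :: 'a and \<rho> :: "('a \<Rightarrow> real) \<Rightarrow> real \<Rightarrow> ennreal" and w :: "('a \<Rightarrow> real) \<Rightarrow> real \<Rightarrow> 'i \<Rightarrow> 'a"
    assume w: "\<And>\<zeta> r. indep_family (I - {p}) (w \<zeta> r)"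
      and meas: "\<And>\<Phi>. \<Phi> \<in> borel_measurable borel \<Longrightarrow>
      (\<lambda>(\<zeta>, r). \<rho> \<zeta> r * flat_integral \<Phi> (I - {p}) (w \<zeta> r)) \<in> borel_measurable (PiM (Basis - {i}) (\<lambda>_. lborel) \<Otimes>\<^sub>M lborel)"
      and eq: "\<And>\<Phi>. \<Phi> \<in> borel_measurable borel \<Longrightarrow>
      flat_integral (\<lambda>x. \<Phi> x * ennreal (1 / (\<Sum>j\<in>Basis. c j * \<bar>x \<bullet> j\<bar>))) I v
        = (\<integral>\<^sup>+\<zeta>. \<integral>\<^sup>+r. \<rho> \<zeta> r * flat_integral \<Phi> (I - {p}) (w \<zeta> r) \<partial>lborel \<partial>PiM (Basis - {i}) (\<lambda>_. lborel))"
    note [measurable] = meas[OF G]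
    let ?M = "PiM (Basis - {i}) (\<lambda>_. lborel :: real measure)"
    have "\<rho> \<zeta> r * flat_integral F (I - {p}) (w \<zeta> r) \<le> C * (\<rho> \<zeta> r * flat_integral G (I - {p}) (w \<zeta> r))" for \<zeta> r
      using I pq by (subst mult.left_commute) (intro mult_left_mono le w, auto)
    then have "(\<integral>\<^sup>+\<zeta>. \<integral>\<^sup>+r. \<rho> \<zeta> r * flat_integral F (I - {p}) (w \<zeta> r) \<partial>lborel \<partial>?M)
      \<le> (\<integral>\<^sup>+\<zeta>. \<integral>\<^sup>+r. C * (\<rho> \<zeta> r * flat_integral G (I - {p}) (w \<zeta> r)) \<partial>lborel \<partial>?M)"
      by (intro nn_integral_mono)
    also have "\<dots> = (\<integral>\<^sup>+\<zeta>. C * (\<integral>\<^sup>+r. \<rho> \<zeta> r * flat_integral G (I - {p}) (w \<zeta> r) \<partial>lborel) \<partial>?M)"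
      by (intro nn_integral_cong nn_integral_cmult) measurable
    also have "\<dots> = C * (\<integral>\<^sup>+\<zeta>. \<integral>\<^sup>+r. \<rho> \<zeta> r * flat_integral G (I - {p}) (w \<zeta> r) \<partial>lborel \<partial>?M)"
      by (rule nn_integral_cmult) measurable
    finally show ?thesis by (simp only: eq[OF F] eq[OF G])
  qed
qed

text \<open>Each induction step spends one factor \<open>1 / N\<close> on passing to hyperplanes;
  the remaining \<open>k\<close> factors are absorbed into the integrands, where the induction
  hypothesis handles them. \<open>m \<ge> 1\<close> keeps at least two vectors in the family at each
  step.\<close>

lemma flat_integral_negative_power_mono:
  fixes F G :: "'a::euclidean_space \<Rightarrow> ennreal" and v :: "'i \<Rightarrow> 'a" and c :: "'a \<Rightarrow> real"
  assumes "m \<ge> 1" and c: "\<And>j. j \<in> Basis \<Longrightarrow> c j > 0"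
    and F [measurable]: "F \<in> borel_measurable borel" and G [measurable]: "G \<in> borel_measurable borel"
    and le: "\<And>J w. finite J \<Longrightarrow> card J = m \<Longrightarrow> indep_family J w \<Longrightarrow>
      flat_integral F (J :: 'i set) w \<le> C * flat_integral G J w"
    and "finite I" "card I = m + k" "indep_family I v"
  shows "flat_integral (\<lambda>x. F x * ennreal (1 / (\<Sum>j\<in>Basis. c j * \<bar>x \<bullet> j\<bar>)) ^ k) I v
    \<le> C * flat_integral (\<lambda>x. G x * ennreal (1 / (\<Sum>j\<in>Basis. c j * \<bar>x \<bullet> j\<bar>)) ^ k) I v"
  using assms(6-)
proof (induction k arbitrary: I v)
  case 0
  then show ?case using le by simp
next
  case (Suc k)
  let ?N = "\<lambda>x. ennreal (1 / (\<Sum>j\<in>Basis. c j * \<bar>x \<bullet> j\<bar>))"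
  have "flat_integral (\<lambda>x. F x * ?N x ^ k * ?N x) I v \<le> C * flat_integral (\<lambda>x. G x * ?N x ^ k * ?N x) I v"
  proof (rule flat_integral_hyperplane_step[OF Suc.prems(1) _ Suc.prems(3) c])
    show "2 \<le> card I" using Suc.prems(2) \<open>m \<ge> 1\<close> by simp
  next
    fix J :: "'i set" and w :: "'i \<Rightarrow> 'a"
    assume "finite J" "card J = card I - 1" "indep_family J w"
    then show "flat_integral (\<lambda>x. F x * ?N x ^ k) J w \<le> C * flat_integral (\<lambda>x. G x * ?N x ^ k) J w"
      using Suc.prems(2) by (intro Suc.IH) auto
  qed measurable
  then show ?case by (simp add: mult_ac)
qed

section \<open>Spans, orthonormal bases and central sections\<close>

lemma flat_integral_Basis:
  fixes \<Phi> :: "'a::euclidean_space \<Rightarrow> ennreal"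
  assumes [measurable]: "\<Phi> \<in> borel_measurable borel"
  shows "flat_integral \<Phi> Basis (\<lambda>i. i) = (\<integral>\<^sup>+x. \<Phi> x \<partial>lborel)"
  unfolding flat_integral_def by (subst lborel_eq, subst nn_integral_distr) auto

lemma indep_family_Basis: "indep_family Basis (\<lambda>i::'a::euclidean_space. i)"
  unfolding indep_family_def
proof (intro allI impI ballI)
  fix c :: "'a \<Rightarrow> real" and i :: 'a assume "(\<Sum>i\<in>Basis. c i *\<^sub>R i) = 0" "i \<in> Basis"
  then show "c i = 0" using inner_sum_left_Basis[of i c] by simp
qed

lemma span_family_eq_range:
  assumes "finite J"
  shows "span (w ` J) = range (\<lambda>c. \<Sum>j\<in>J. c j *\<^sub>R w j)"
proof
  show "range (\<lambda>c. \<Sum>j\<in>J. c j *\<^sub>R w j) \<subseteq> span (w ` J)"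
    by (clarsimp simp: span_sum span_scale span_base)
  show "span (w ` J) \<subseteq> range (\<lambda>c. \<Sum>j\<in>J. c j *\<^sub>R w j)"
  proof (rule span_minimal)
    show "w ` J \<subseteq> range (\<lambda>c. \<Sum>j\<in>J. c j *\<^sub>R w j)"
    proof
      fix x assume "x \<in> w ` J"
      then obtain i where "i \<in> J" "x = w i" by auto
      then have "x = (\<Sum>j\<in>J. (if j = i then 1 else 0) *\<^sub>R w j)"
        using assms by (simp add: if_distrib[of "\<lambda>c. c *\<^sub>R _"] cong: if_cong)
      then show "x \<in> range (\<lambda>c. \<Sum>j\<in>J. c j *\<^sub>R w j)"
        by (auto intro!: image_eqI[where x = "\<lambda>j. if j = i then 1 else 0"])
    qed
    show "subspace (range (\<lambda>c. \<Sum>j\<in>J. c j *\<^sub>R w j))"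
      unfolding subspace_def
    proof (intro conjI ballI allI)
      show "0 \<in> range (\<lambda>c. \<Sum>j\<in>J. c j *\<^sub>R w j)"
        by (rule image_eqI[of _ _ "\<lambda>_. 0"]) auto
    next
      fix x y assume "x \<in> range (\<lambda>c. \<Sum>j\<in>J. c j *\<^sub>R w j)" "y \<in> range (\<lambda>c. \<Sum>j\<in>J. c j *\<^sub>R w j)"
      then obtain c d where "x = (\<Sum>j\<in>J. c j *\<^sub>R w j)" "y = (\<Sum>j\<in>J. d j *\<^sub>R w j)" by blast
      then have "x + y = (\<Sum>j\<in>J. (c j + d j) *\<^sub>R w j)" by (simp add: scaleR_add_left sum.distrib)
      then show "x + y \<in> range (\<lambda>c. \<Sum>j\<in>J. c j *\<^sub>R w j)"
        by (auto intro!: image_eqI[where x = "\<lambda>j. c j + d j"])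
    next
      fix r :: real and x assume "x \<in> range (\<lambda>c. \<Sum>j\<in>J. c j *\<^sub>R w j)"
      then obtain c where "x = (\<Sum>j\<in>J. c j *\<^sub>R w j)" by blast
      then have "r *\<^sub>R x = (\<Sum>j\<in>J. (r * c j) *\<^sub>R w j)" by (simp add: scaleR_sum_right)
      then show "r *\<^sub>R x \<in> range (\<lambda>c. \<Sum>j\<in>J. c j *\<^sub>R w j)"
        by (auto intro!: image_eqI[where x = "\<lambda>j. r * c j"])
    qed
  qed
qed

lemma dim_span_indep_family:
  fixes w :: "'i \<Rightarrow> 'a::euclidean_space"
  assumes J: "finite J" and w: "indep_family J w"
  shows "dim (span (w ` J)) = card J"
proof -
  have inj: "inj_on w J"
  proof (rule inj_onI, rule ccontr)
    fix a b assume ab: "a \<in> J" "b \<in> J" "w a = w b" "a \<noteq> b"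
    define c where "c j = (if j = a then 1 else 0) - (if j = b then 1 else 0 :: real)" for j
    have "(\<Sum>j\<in>J. c j *\<^sub>R w j) = 0"
      using ab J by (simp add: c_def scaleR_diff_left sum_subtractf if_distrib[of "\<lambda>c. c *\<^sub>R _"] cong: if_cong)
    then have "c a = 0" using w ab unfolding indep_family_def by blast
    then show False using ab by (simp add: c_def)
  qed
  have "independent (w ` J)"
  proof (rule independent_if_scalars_zero)
    fix f x assume sum0: "(\<Sum>x\<in>w ` J. f x *\<^sub>R x) = 0" and "x \<in> w ` J"
    then obtain i where i: "i \<in> J" "x = w i" by auto
    have "(\<Sum>j\<in>J. f (w j) *\<^sub>R w j) = 0" using sum0 by (simp add: sum.reindex[OF inj])
    then show "f x = 0" using w[unfolded indep_family_def, rule_format, of "\<lambda>j. f (w j)"] i by simp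
  qed (use J in simp)
  then have "dim (w ` J) = card (w ` J)" by (rule dim_eq_card_independent)
  then show ?thesis by (simp add: card_image[OF inj])
qed

text \<open>Guarantees that the choice made inside \<open>section_integral\<close> is an actual
  orthonormal basis.\<close>

lemma onb_of_SOME:
  fixes H :: "'a::euclidean_space set"
  assumes "subspace H"
  shows "onb_of H (SOME b. onb_of H b)"
proof -
  obtain B where B: "B \<subseteq> H" "pairwise orthogonal B" "\<And>x. x \<in> B \<Longrightarrow> norm x = 1"
    "independent B" "card B = dim H" "span B = H"
    using orthonormal_basis_subspace[OF assms] by metis
  have "finite B" using B(4) by (rule independent_imp_finite)
  then obtain b where "bij_betw b {0..<card B} B" using ex_bij_betw_nat_finite by blast
  then have b: "bij_betw b {..<dim H} B" using B(5) by (simp add: atLeast0LessThan)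
  have "onb_of H b"
    unfolding onb_of_def
  proof (intro conjI allI impI)
    show "span (b ` {..<dim H}) = H" using b B(6) by (simp add: bij_betw_def)
  next
    fix i j assume ij: "i < dim H" "j < dim H"
    then have mem: "b i \<in> B" "b j \<in> B" using b by (auto simp: bij_betw_def)
    show "b i \<bullet> b j = (if i = j then 1 else 0)"
    proof (cases "i = j")
      case True then show ?thesis using B(3)[OF mem(1)] by (simp add: dot_square_norm)
    next
      case False
      then have "b i \<noteq> b j" using b ij by (auto simp: bij_betw_def inj_on_def)
      then show ?thesis using False B(2) mem by (auto simp: pairwise_def orthogonal_def)
    qed
  qed
  then show ?thesis by (rule someI[of "onb_of H"])
qed

lemma onb_of_norm:
  assumes "onb_of H b"
  shows "norm (\<Sum>i<dim H. t i *\<^sub>R b i) = sqrt (\<Sum>i<dim H. (t i)\<^sup>2)"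
proof -
  have "(\<Sum>i<dim H. t i *\<^sub>R b i) \<bullet> (\<Sum>i<dim H. t i *\<^sub>R b i)
    = (\<Sum>i<dim H. \<Sum>j<dim H. t j * (t i * (b i \<bullet> b j)))"
    by (simp add: inner_sum_left inner_sum_right sum_distrib_left inner_commute)
  also have "\<dots> = (\<Sum>i<dim H. \<Sum>j<dim H. if j = i then t i * t j else 0)"
    using assms by (intro sum.cong refl) (auto simp: onb_of_def)
  also have "\<dots> = (\<Sum>i<dim H. (t i)\<^sup>2)" by (simp add: power2_eq_square)
  finally show ?thesis by (simp add: norm_eq_sqrt_inner)
qed

lemma flat_integral_onb_cball:
  fixes H :: "'a::euclidean_space set"
  assumes b: "onb_of H b" and r: "r > 0"
  shows "flat_integral (indicator (cball 0 r)) {..<dim H} b = ennreal (unit_ball_vol (real (dim H)) * r ^ dim H)"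
proof -
  let ?M = "PiM {..<dim H} (\<lambda>_. lborel :: real measure)"
  have "flat_integral (indicator (cball 0 r)) {..<dim H} b
     = (\<integral>\<^sup>+t. indicator ({f. sqrt (\<Sum>i<dim H. (f i)\<^sup>2) \<le> r} \<inter> space ?M) t \<partial>?M)"
    unfolding flat_integral_def by (intro nn_integral_cong) (auto simp: indicator_def onb_of_norm[OF b])
  also have "\<dots> = emeasure ?M ({f. sqrt (\<Sum>i<dim H. (f i)\<^sup>2) \<le> r} \<inter> space ?M)"
  proof (rule nn_integral_indicator)
    have "{f \<in> space ?M. sqrt (\<Sum>i<dim H. (f i)\<^sup>2) \<le> r} \<in> sets ?M" by measurable
    then show "{f. sqrt (\<Sum>i<dim H. (f i)\<^sup>2) \<le> r} \<inter> space ?M \<in> sets ?M" by (simp add: Int_def conj_commute)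
  qed
  also have "\<dots> = ennreal (unit_ball_vol (real (card {..<dim H})) * r ^ card {..<dim H})"
    using r by (intro emeasure_cball_aux) auto
  finally show ?thesis by simp
qed

text \<open>\<open>section_integral\<close> is a Bochner integral, with value 0 for non-integrable
  functions, so integrability has to come from the bounds \<open>A\<close> and \<open>R\<close>. The
  last bound depends on \<open>H\<close> only through its dimension, which makes the later supremum
  finite.\<close>

lemma section_integral_flat_integral:
  fixes L H :: "'a::euclidean_space set" and g :: "'a \<Rightarrow> real"
  assumes L: "compact L" and g: "continuous_on L g" "\<And>x. x \<in> L \<Longrightarrow> g x \<ge> 0"
    and R: "R > 0" "L \<subseteq> cball 0 R" and A: "\<And>x. x \<in> L \<Longrightarrow> g x \<le> A" "A \<ge> 0" and H: "subspace H"
  shows "flat_integral (\<lambda>x. ennreal (indicator L x * g x)) {..<dim H} (SOME b. onb_of H b)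
      = ennreal (section_integral g L H)"
    and "0 \<le> section_integral g L H"
    and "section_integral g L H \<le> A * (unit_ball_vol (real (dim H)) * R ^ dim H)"
proof -
  define b where "b = (SOME b. onb_of H b)"
  have b: "onb_of H b" unfolding b_def by (rule onb_of_SOME[OF H])
  let ?M = "PiM {..<dim H} (\<lambda>_. lborel :: real measure)"
  have "L \<in> sets borel" using L by (simp add: borel_closed compact_imp_closed)
  from borel_measurable_continuous_on_indicator[OF this g(1)]
  have [measurable]: "(\<lambda>x. indicator L x * g x) \<in> borel_measurable borel" by simp
  let ?f = "\<lambda>t. indicator L (\<Sum>i<dim H. t i *\<^sub>R b i) * g (\<Sum>i<dim H. t i *\<^sub>R b i)"
  have f0: "0 \<le> ?f t" for t using g(2) by (simp add: indicator_def)
  have fm: "?f \<in> borel_measurable ?M"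
    by (rule measurable_compose[of _ _ borel "\<lambda>x. indicator L x * g x"]) measurable
  have eq: "section_integral g L H = (\<integral>t. ?f t \<partial>?M)"
    by (simp add: section_integral_def b_def Let_def)
  have "(\<integral>\<^sup>+t. ennreal (?f t) \<partial>?M) \<le> (\<integral>\<^sup>+t. ennreal A * indicator (cball 0 R) (\<Sum>i<dim H. t i *\<^sub>R b i) \<partial>?M)"
    using R A g(2) by (intro nn_integral_mono) (auto simp: indicator_def ennreal_leI)
  also have "\<dots> = ennreal A * flat_integral (indicator (cball 0 R)) {..<dim H} b"
    unfolding flat_integral_def
    by (rule nn_integral_cmult, rule measurable_compose[of _ _ borel "indicator (cball 0 R)"]) (auto intro: borel_measurable_indicator)
  also have "\<dots> = ennreal (A * (unit_ball_vol (real (dim H)) * R ^ dim H))"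
    using A R by (subst flat_integral_onb_cball[OF b]) (auto simp: ennreal_mult)
  finally have bound: "(\<integral>\<^sup>+t. ennreal (?f t) \<partial>?M) \<le> ennreal (A * (unit_ball_vol (real (dim H)) * R ^ dim H))" .
  have int: "integrable ?M ?f"
    by (rule integrableI_nonneg[OF fm]) (use f0 bound in \<open>auto intro: le_less_trans\<close>)
  have nn: "(\<integral>\<^sup>+t. ennreal (?f t) \<partial>?M) = ennreal (section_integral g L H)"
    unfolding eq by (rule nn_integral_eq_integral[OF int]) (use f0 in auto)
  then show "flat_integral (\<lambda>x. ennreal (indicator L x * g x)) {..<dim H} (SOME b. onb_of H b)
      = ennreal (section_integral g L H)"
    by (simp add: flat_integral_def flip: b_def)
  show "0 \<le> section_integral g L H" unfolding eq using f0 by simp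
  have "0 \<le> A * (unit_ball_vol (real (dim H)) * R ^ dim H)" using A R by simp
  then show "section_integral g L H \<le> A * (unit_ball_vol (real (dim H)) * R ^ dim H)"
    using bound unfolding nn by (simp add: ennreal_le_iff)
qed

text \<open>The family \<open>w\<close> and an orthonormal basis of its span differ by an unknown
  factor. Comparing with the unit ball removes it, since the ball has a known integral in the
  orthonormal parametrisation.\<close>

lemma flat_integral_le_of_sections:
  fixes F :: "'a::euclidean_space \<Rightarrow> ennreal" and w :: "'i \<Rightarrow> 'a"
  assumes J: "finite J" and w: "indep_family J w" and [measurable]: "F \<in> borel_measurable borel"
    and le: "\<And>H. H \<in> Grass (card J) \<Longrightarrow> flat_integral F {..<dim H} (SOME b. onb_of H b) \<le> ennreal \<epsilon>"
    and \<epsilon>: "\<epsilon> \<ge> 0"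
  shows "flat_integral F J w \<le> ennreal (\<epsilon> / unit_ball_vol (real (card J))) * flat_integral (indicator (cball 0 1)) J w"
proof -
  define H where "H = span (w ` J)"
  define b where "b = (SOME b. onb_of H b)"
  let ?G = "indicator (cball 0 1) :: 'a \<Rightarrow> ennreal"
  have sub: "subspace H" by (simp add: H_def)
  have b: "onb_of H b" unfolding b_def by (rule onb_of_SOME[OF sub])
  have dimH: "dim H = card J" unfolding H_def by (rule dim_span_indep_family[OF J w])
  have Hw: "H = range (\<lambda>c. \<Sum>j\<in>J. c j *\<^sub>R w j)" unfolding H_def by (rule span_family_eq_range[OF J])
  have Hb: "H = range (\<lambda>c. \<Sum>i<dim H. c i *\<^sub>R b i)"
    using span_family_eq_range[of "{..<dim H}" b] b by (simp add: onb_of_def)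
  define \<beta> where "\<beta> = unit_ball_vol (real (card J))"
  have \<beta>: "\<beta> > 0" by (simp add: \<beta>_def)
  have G: "flat_integral ?G {..<dim H} b = ennreal \<beta>"
    using flat_integral_onb_cball[OF b, of 1] by (simp add: \<beta>_def dimH)
  have proportional: "flat_integral F J w * flat_integral ?G {..<dim H} b = flat_integral ?G J w * flat_integral F {..<dim H} b"
  proof (rule flat_integral_proportional[OF J])
    show "\<exists>c. (\<Sum>j\<in>J. t j *\<^sub>R w j) = (\<Sum>i<dim H. c i *\<^sub>R b i)" for t
      using Hw Hb by blast
    show "\<exists>c. (\<Sum>i<dim H. t i *\<^sub>R b i) = (\<Sum>j\<in>J. c j *\<^sub>R w j)" for t
      using Hw Hb by blast
  qed (auto intro: borel_measurable_indicator)
  \<comment> \<open>Multiplying by \<open>\<beta> * (1 / \<beta>)\<close> avoids a cancellation in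
    \<open>ennreal\<close>, where the values may be infinite.\<close>
  have "flat_integral F J w = flat_integral F J w * (ennreal \<beta> * ennreal (1 / \<beta>))"
    using \<beta> by (simp add: ennreal_mult[symmetric])
  also have "\<dots> = flat_integral ?G J w * flat_integral F {..<dim H} b * ennreal (1 / \<beta>)"
    using proportional by (simp add: G mult.assoc[symmetric])
  also have "\<dots> \<le> flat_integral ?G J w * ennreal \<epsilon> * ennreal (1 / \<beta>)"
  proof (intro mult_right_mono mult_left_mono)
    show "flat_integral F {..<dim H} b \<le> ennreal \<epsilon>"
      unfolding b_def by (rule le) (simp add: Grass_def sub dimH)
  qed auto
  also have "\<dots> = ennreal (\<epsilon> / \<beta>) * flat_integral ?G J w"
    using \<epsilon> \<beta> ennreal_mult[of \<epsilon> "1 / \<beta>"] by (simp add: mult_ac)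
  finally show ?thesis by (simp add: \<beta>_def)
qed

section \<open>Assembling the slicing estimate and its constant\<close>

theorem theorem2:
  fixes L :: "'a::euclidean_space set" and g :: "'a \<Rightarrow> real" and k :: nat
  assumes "DIM('a) \<ge> 2"
    and "1 \<le> k" and "k < DIM('a)"
    and "convex_body L" and "unconditional L"
    and "continuous_on L g"
    and "\<forall>x\<in>L. g x \<ge> 0"
    and "\<forall>x\<in>L. g (- x) = g x"
  shows "integral L g \<le>
           exp (real k) * (real DIM('a) / (real DIM('a) - real k)) * c_nk DIM('a) k
           * (SUP H\<in>Grass (DIM('a) - k). section_integral g L H)
           * measure lebesgue L powr (real k / real DIM('a))"
proof -
  define n m where "n = DIM('a)" and "m = n - k"
  have m: "m \<ge> 1" "n = m + k" "n > 0" "real m = real n - real k" using assms(2,3) by (auto simp: n_def m_def)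
  have nk: "real n - real k > 0" using assms(3) by (simp add: n_def)
  have L: "compact L" "convex L" "0 \<in> interior L" using assms(4) by (auto simp: convex_body_def)
  have g0: "\<And>x. x \<in> L \<Longrightarrow> g x \<ge> 0" using assms(7) by blast
  obtain R0 where "\<And>x. x \<in> L \<Longrightarrow> norm x \<le> R0"
    using compact_imp_bounded[OF L(1)] by (auto simp: bounded_iff)
  then have R: "max R0 1 > 0" "L \<subseteq> cball 0 (max R0 1)" by (force simp: le_max_iff_disj)+
  define R where "R = max R0 1"
  have "L \<noteq> {}" using L(3) interior_subset by blast
  then obtain A where A: "\<And>x. x \<in> L \<Longrightarrow> g x \<le> A" "A \<ge> 0"
    using continuous_attains_sup[OF L(1) _ assms(6)] g0 by metis
  note sections = section_integral_flat_integral[OF L(1) assms(6) g0 R[folded R_def] A]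
  define \<epsilon> where "\<epsilon> = (SUP H\<in>Grass m. section_integral g L (H :: 'a set))"
  \<comment> \<open>A real supremum dominates the members only of a set bounded above.\<close>
  have bdd: "bdd_above (section_integral g L ` Grass m)"
    by (rule bdd_aboveI[of _ "A * (unit_ball_vol (real m) * R ^ m)"]) (auto simp: Grass_def intro: sections(3))
  have sec_le: "section_integral g L H \<le> \<epsilon>" if "H \<in> Grass m" for H
    unfolding \<epsilon>_def using that bdd by (rule cSUP_upper)
  \<comment> \<open>One member of \<open>Grass m\<close> suffices for
    \<open>\<epsilon> \<ge> 0\<close>, which the later passage between \<open>ennreal\<close> and
    real products requires.\<close>
  obtain S :: "'a set" where "subspace S" "dim S = m"
    using choose_subspace_of_subspace[of m "UNIV :: 'a set"] m by (auto simp: n_def)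
  then have \<epsilon>0: "\<epsilon> \<ge> 0"
    using sec_le[of S] sections(2)[of S] by (auto simp: Grass_def)
  obtain a where a: "\<And>i. i \<in> Basis \<Longrightarrow> a \<bullet> i > 0" "cbox (- a) a \<subseteq> L"
    "\<And>x. x \<in> L \<Longrightarrow> (\<Sum>i\<in>Basis. \<bar>x \<bullet> i\<bar> / (a \<bullet> i)) \<le> n"
    using unconditional_position[OF assms(4,5)] unfolding n_def by metis
  \<comment> \<open>The factor \<open>1 / n\<close> normalises the enclosing cross-polytope to
    \<open>{x. N x \<le> 1}\<close>.\<close>
  define c where "c j = 1 / (real n * (a \<bullet> j))" for j
  have c: "c j > 0" if "j \<in> Basis" for j using a(1)[OF that] m(3) by (simp add: c_def)
  define N where "N x = (\<Sum>j\<in>Basis. c j * \<bar>x \<bullet> j\<bar>)" for x :: 'a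
  have [measurable]: "N \<in> borel_measurable borel" unfolding N_def[abs_def] by measurable
  have N0: "N x \<ge> 0" for x unfolding N_def using c by (intro sum_nonneg mult_nonneg_nonneg) (auto intro: less_imp_le)
  have N_eq: "N x = (\<Sum>j\<in>Basis. \<bar>x \<bullet> j\<bar> / (a \<bullet> j)) / real n" for x
    by (simp add: N_def c_def sum_divide_distrib mult.commute)
  have N1: "N x \<le> 1" if "x \<in> L" for x using a(3)[OF that] m(3) by (simp add: N_eq)
  have Npos: "N x > 0" if x0: "x \<noteq> 0" for x
  proof -
    obtain i where i: "i \<in> Basis" "x \<bullet> i \<noteq> 0" using x0 euclidean_all_zero_iff by blast
    have "0 < c i * \<bar>x \<bullet> i\<bar>" using c[OF i(1)] i(2) by simp
    also have "\<dots> \<le> N x" unfolding N_def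
      by (rule member_le_sum[OF i(1)]) (auto intro!: mult_nonneg_nonneg less_imp_le[OF c])
    finally show ?thesis .
  qed
  define vol where "vol = measure lebesgue L"
  have Lb: "L \<in> sets borel" using L by (simp add: borel_closed compact_imp_closed)
  have fin: "emeasure lborel L < \<infinity>" by (rule emeasure_compact_finite[OF L(1)])
  have vol: "vol = measure lborel L" unfolding vol_def by (rule measure_completion) (use Lb in simp)
  have box_le: "(\<Prod>i\<in>Basis. 2 * (a \<bullet> i)) \<le> vol"
  proof -
    have "measure lborel (cbox (- a) a) \<le> vol"
      unfolding vol by (rule measure_mono_fmeasurable[OF a(2)]) (use fin Lb in \<open>auto simp: fmeasurable_def\<close>)
    moreover have "measure lborel (cbox (- a) a) = (\<Prod>i\<in>Basis. 2 * (a \<bullet> i))"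
      using a(1) by (subst content_cbox) (auto intro: less_imp_le)
    ultimately show ?thesis by simp
  qed
  have "(\<Prod>i\<in>Basis. 2 * (a \<bullet> i)) > 0" using a(1) by (intro prod_pos) auto
  then have vol0: "vol > 0" using box_le by simp
  define V where "V = exp (real n) * vol"
  have V: "V > 0" using vol0 by (simp add: V_def)
  \<comment> \<open>This level set is the weighted l1-ball of radius \<open>n\<close> for the box
    \<open>r *\<^sub>R a\<close>, so the exponential factor is \<open>exp n\<close> for every
    \<open>r\<close>.\<close>
  have level: "emeasure lborel {x. N x \<le> r} \<le> ennreal (V * r ^ n)" if r: "r > 0" for r
  proof -
    have "N x \<le> r \<longleftrightarrow> (\<Sum>i\<in>Basis. \<bar>x \<bullet> i\<bar> / ((r *\<^sub>R a) \<bullet> i)) \<le> real n" for x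
    proof -
      have eq: "(\<Sum>i\<in>Basis. \<bar>x \<bullet> i\<bar> / ((r *\<^sub>R a) \<bullet> i)) = (\<Sum>i\<in>Basis. \<bar>x \<bullet> i\<bar> / (a \<bullet> i)) / r"
        by (simp add: sum_divide_distrib mult.commute)
      show ?thesis unfolding N_eq eq using r m(3) by (simp add: pos_divide_le_eq mult.commute)
    qed
    then have "emeasure lborel {x. N x \<le> r} \<le> ennreal (exp (real n) * (\<Prod>i\<in>Basis. 2 * ((r *\<^sub>R a) \<bullet> i)))"
      using emeasure_weighted_l1_ball_le[of "r *\<^sub>R a" "real n"] a(1) r by simp
    also have "(\<Prod>i\<in>Basis. 2 * ((r *\<^sub>R a) \<bullet> i)) = r ^ n * (\<Prod>i\<in>Basis. 2 * (a \<bullet> i))"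
      by (simp add: n_def prod.distrib mult.left_commute[of 2])
    also have "ennreal (exp (real n) * (r ^ n * (\<Prod>i\<in>Basis. 2 * (a \<bullet> i)))) \<le> ennreal (V * r ^ n)"
      using box_le r by (intro ennreal_leI) (simp add: V_def mult.assoc mult.commute[of _ "r ^ n"])
    finally show ?thesis .
  qed
  define F where "F x = ennreal (indicator L x * g x)" for x
  let ?G = "indicator (cball 0 1) :: 'a \<Rightarrow> ennreal"
  let ?b = "real n / (real n - real k) * unit_ball_vol (real n) powr ((real n - real k) / real n) * V powr (real k / real n)"
  have [measurable]: "F \<in> borel_measurable borel"
    using borel_measurable_continuous_on_indicator[OF Lb assms(6)] unfolding F_def by simp
  have [measurable]: "?G \<in> borel_measurable borel" by (intro borel_measurable_indicator) simp
  have int: "set_integrable lborel L g"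
    using borel_integrable_compact[OF L(1) assms(6)] by (simp add: set_integrable_def)
  have "(\<integral>\<^sup>+x. F x \<partial>lborel) = ennreal (\<integral>x. indicator L x * g x \<partial>lborel)"
    unfolding F_def using int g0
    by (intro nn_integral_eq_integral) (auto simp: set_integrable_def indicator_def)
  also have "(\<integral>x. indicator L x * g x \<partial>lborel) = integral L g"
    using set_borel_integral_eq_integral(2)[OF int] by (simp add: set_lebesgue_integral_def)
  finally have "ennreal (integral L g) = (\<integral>\<^sup>+x. F x \<partial>lborel)" ..
  also have "\<dots> \<le> (\<integral>\<^sup>+x. F x * ennreal (1 / N x) ^ k \<partial>lborel)"
  proof (rule nn_integral_mono_AE)
    \<comment> \<open>At the origin \<open>1 / N x = 0\<close> by convention, so the pointwise bound
      \<open>1 \<le> 1 / N x\<close> on \<open>L\<close> fails there and only there.\<close>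
    have "AE x in lborel. x \<noteq> (0::'a)" by (rule AE_lborel_singleton)
    then show "AE x in lborel. F x \<le> F x * ennreal (1 / N x) ^ k"
    proof eventually_elim
      case (elim x)
      show ?case
      proof (cases "x \<in> L")
        case True
        then have "1 \<le> ennreal (1 / N x)" using Npos[OF elim] N1 by (simp add: one_ennreal_def[symmetric] del: ennreal_1 flip: ennreal_1)
        then have "F x * 1 \<le> F x * ennreal (1 / N x) ^ k" by (intro mult_left_mono one_le_power) auto
        then show ?thesis by simp
      qed (simp add: F_def)
    qed
  qed
  also have "\<dots> = flat_integral (\<lambda>x. F x * ennreal (1 / N x) ^ k) Basis (\<lambda>i. i)"
    by (rule flat_integral_Basis[symmetric]) measurable
  also have "\<dots> \<le> ennreal (\<epsilon> / unit_ball_vol (real m)) * flat_integral (\<lambda>x. ?G x * ennreal (1 / N x) ^ k) Basis (\<lambda>i. i)"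
    unfolding N_def
  proof (rule flat_integral_negative_power_mono[OF m(1) c])
    fix J :: "'a set" and w :: "'a \<Rightarrow> 'a"
    assume J: "finite J" "card J = m" "indep_family J w"
    show "flat_integral F J w \<le> ennreal (\<epsilon> / unit_ball_vol (real m)) * flat_integral ?G J w"
      unfolding J(2)[symmetric]
    proof (rule flat_integral_le_of_sections[OF J(1,3) _ _ \<epsilon>0])
      fix H :: "'a set" assume H: "H \<in> Grass (card J)"
      then show "flat_integral F {..<dim H} (SOME b. onb_of H b) \<le> ennreal \<epsilon>"
        unfolding F_def using sections(1)[of H] sec_le[of H] J(2) by (simp add: Grass_def ennreal_leI)
    qed measurable
  qed (use m(2) in \<open>auto simp: n_def indep_family_Basis intro: borel_measurable_indicator\<close>)
  also have "\<dots> \<le> ennreal (\<epsilon> / unit_ball_vol (real m)) * ennreal ?b"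
  proof (rule mult_left_mono)
    have "flat_integral (\<lambda>x. ?G x * ennreal (1 / N x) ^ k) Basis (\<lambda>i. i) = (\<integral>\<^sup>+x. ?G x * ennreal (1 / N x ^ k) \<partial>lborel)"
      using N0 by (subst flat_integral_Basis) (auto simp: ennreal_power power_one_over)
    also have "\<dots> \<le> ennreal ?b"
      by (rule nn_integral_negative_power_le) (use N0 V level assms(2,3) in \<open>auto simp: n_def emeasure_cball\<close>)
    finally show "flat_integral (\<lambda>x. ?G x * ennreal (1 / N x) ^ k) Basis (\<lambda>i. i) \<le> ennreal ?b" .
  qed simp
  also have "\<dots> = ennreal (\<epsilon> / unit_ball_vol (real m) * ?b)"
    using \<epsilon>0 nk by (intro ennreal_mult[symmetric]) auto
  finally have "integral L g \<le> \<epsilon> / unit_ball_vol (real m) * ?b"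
    using \<epsilon>0 nk by (subst (asm) ennreal_le_iff) (auto intro!: mult_nonneg_nonneg)
  also have "V powr (real k / real n) = exp (real k) * vol powr (real k / real n)"
    using vol0 m(3) by (simp add: V_def powr_mult exp_powr_real)
  finally show ?thesis
    unfolding m(4) unfolding c_nk_def vol_def \<epsilon>_def m_def n_def by (simp add: mult_ac)
qed

end
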